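(* Let $\alpha\in(0,\frac32)$. Then there exist $z_0:\mathbb{R}^3\to\mathbb{R}^3$, $f:\mathbb{R}_+\times\mathbb{R}^3\to\mathbb{R}^3$ and $g:\mathbb{R}_+\times\mathbb{R}^3\to\mathbb{R}^3$ such that the solution $z$ of the Stokes equation $$\partial_t z-\Delta z+\nabla Q=f+\partial_t g,\qquad \operatorname{div}z=0,\qquad z(0)=z_0\qquad\text{in }\mathbb{R}_+\times\mathbb{R}^3$$ has the following properties: (i) $z\in L^\infty(0,\infty;[L^2(\mathbb{R}^3)]^3)\cap L^2(0,\infty;[H^1(\mathbb{R}^3)]^3)$; (ii) $z$ has compact support in $[0,\infty)\times\mathbb{R}^3$; (iii) $z(t)\in C^\infty(\mathbb{R}^3)$ for each $t\ge0$; (iv) the singular set $S(z)$ has Hausdorff dimension at least $\alpha$.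
   Context: The functions $f,g$ are locally integrable and the Stokes equation is understood in the sense of distributions (with initial condition $z_0$). A space-time point $(t,x)$ is regular for a vector field $u$ if $u$ is essentially bounded in some neighbourhood of $(t,x)$; it is singular otherwise; $S(u)$ denotes the set of all singular points of $u$, a subset of space-time. *)

theory Defs
  imports "HOL-Analysis.Analysis"
begin

section \<open>Smooth functions, test functions and distributions\<close>

definition dirderiv ::
  "'a::real_normed_vector \<Rightarrow> ('a \<Rightarrow> 'b::real_normed_vector) \<Rightarrow> 'a \<Rightarrow> 'b" where
  "dirderiv v \<phi> x = frechet_derivative \<phi> (at x) v"

text \<open>All iterated directional derivatives exist and are differentiable (hence continuous);
  in finite dimensions this is \<open>C\<^sup>\<infinity>\<close> on the whole space.\<close>

definition smooth :: "('a::euclidean_space \<Rightarrow> 'b::real_normed_vector) \<Rightarrow> bool" where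
  "smooth \<phi> \<longleftrightarrow> (\<forall>vs x. fold dirderiv vs \<phi> differentiable (at x))"

definition supp :: "('a::topological_space \<Rightarrow> 'b::zero) \<Rightarrow> 'a set" where
  "supp \<phi> = closure {x. \<phi> x \<noteq> 0}"

definition test_functions ::
  "'a::euclidean_space set \<Rightarrow> ('a \<Rightarrow> 'b::real_normed_vector) set" where
  "test_functions \<Omega> = {\<phi>. smooth \<phi> \<and> compact (supp \<phi>) \<and> supp \<phi> \<subseteq> \<Omega>}"

text \<open>The last clause is continuity on test functions: over each compact set, the functional is
  bounded by a multiple of a \<open>C\<^sup>N\<close> norm. The variable \<open>M\<close> ranges over the upper bounds of that
  norm. The values of a distribution outside the test functions are irrelevant.\<close>

definition distribution_on ::
  "'a::euclidean_space set \<Rightarrow> (('a \<Rightarrow> real) \<Rightarrow> real) \<Rightarrow> bool" where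
  "distribution_on \<Omega> T \<longleftrightarrow>
     (\<forall>\<phi>\<in>test_functions \<Omega>. \<forall>\<psi>\<in>test_functions \<Omega>. T (\<lambda>x. \<phi> x + \<psi> x) = T \<phi> + T \<psi>) \<and>
     (\<forall>\<phi>\<in>test_functions \<Omega>. \<forall>c. T (\<lambda>x. c * \<phi> x) = c * T \<phi>) \<and>
     (\<forall>K. compact K \<and> K \<subseteq> \<Omega> \<longrightarrow>
        (\<exists>C N. \<forall>\<phi>\<in>test_functions \<Omega>. \<forall>M. supp \<phi> \<subseteq> K \<and>
           (\<forall>vs x. set vs \<subseteq> Basis \<and> length vs \<le> N \<longrightarrow> \<bar>fold dirderiv vs \<phi> x\<bar> \<le> M)
           \<longrightarrow> \<bar>T \<phi>\<bar> \<le> C * M))"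

definition locally_integrable ::
  "'a::euclidean_space set \<Rightarrow> ('a \<Rightarrow> 'b::euclidean_space) \<Rightarrow> bool" where
  "locally_integrable D u \<longleftrightarrow> (\<forall>K. compact K \<and> K \<subseteq> D \<longrightarrow> u absolutely_integrable_on K)"

section \<open>Bochner spaces over \<open>(0, \<infinity>)\<close> with values in \<open>L\<^sup>2\<close> and \<open>H\<^sup>1\<close>\<close>

text \<open>Squares of norms, extended by \<open>\<infinity>\<close> outside the respective space.\<close>

definition L2_sqnorm :: "(real^3 \<Rightarrow> 'b::euclidean_space) \<Rightarrow> ennreal" where
  "L2_sqnorm u =
     (if u \<in> borel_measurable lebesgue then \<integral>\<^sup>+x. ennreal ((norm (u x))\<^sup>2) \<partial>lebesgue else \<infinity>)"

text \<open>\<open>G x $ i $ j\<close> is the weak derivative of the \<open>i\<close>-th component of \<open>u\<close> in direction \<open>j\<close>.\<close>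

definition has_weak_gradient :: "(real^3 \<Rightarrow> real^3) \<Rightarrow> (real^3 \<Rightarrow> real^3^3) \<Rightarrow> bool" where
  "has_weak_gradient u G \<longleftrightarrow>
     locally_integrable UNIV u \<and> locally_integrable UNIV G \<and>
     (\<forall>\<psi>\<in>test_functions UNIV. \<forall>i j.
        (\<integral>x. u x $ i * dirderiv (axis j 1) \<psi> x \<partial>lebesgue) =
        - (\<integral>x. G x $ i $ j * \<psi> x \<partial>lebesgue))"

text \<open>The weak gradient is unique up to null sets, so the infimum ranges over at most one value;
  it is \<open>\<infinity>\<close> if there is no weak gradient. The norm on \<open>real^3^3\<close> is the Frobenius norm.\<close>

definition H1_sqnorm :: "(real^3 \<Rightarrow> real^3) \<Rightarrow> ennreal" where
  "H1_sqnorm u = (INF G \<in> {G. has_weak_gradient u G}. L2_sqnorm u + L2_sqnorm G)"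

text \<open>Strong (Bochner) measurability of \<open>t \<mapsto> u t\<close> on \<open>(0, \<infinity>)\<close> with values in the space
  \<open>{v. N v < \<infinity>}\<close>, where \<open>N\<close> is the squared norm: almost everywhere limit of simple functions.\<close>

definition bochner_measurable ::
  "((real^3 \<Rightarrow> real^3) \<Rightarrow> ennreal) \<Rightarrow> (real \<Rightarrow> real^3 \<Rightarrow> real^3) \<Rightarrow> bool" where
  "bochner_measurable N u \<longleftrightarrow>
     (\<exists>s. (\<forall>n. simple_function (lebesgue_on {0<..}) (s n) \<and> (\<forall>t>0. N (s n t) < \<infinity>)) \<and>
          (AE t in lebesgue_on {0<..}. (\<lambda>n. N (\<lambda>x. u t x - s n t x)) \<longlonglongrightarrow> 0))"

definition Linf_L2 :: "(real \<Rightarrow> real^3 \<Rightarrow> real^3) set" where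
  "Linf_L2 = {u. bochner_measurable L2_sqnorm u \<and>
     (\<exists>C<\<infinity>. AE t in lebesgue_on {0<..}. L2_sqnorm (u t) \<le> C)}"

definition L2_H1 :: "(real \<Rightarrow> real^3 \<Rightarrow> real^3) set" where
  "L2_H1 = {u. bochner_measurable H1_sqnorm u \<and>
     (\<integral>\<^sup>+t. H1_sqnorm (u t) \<partial>lebesgue_on {0<..}) < \<infinity>}"

section \<open>The Stokes equation\<close>

text \<open>Space-time functions are total functions of \<open>t\<close> and \<open>x\<close>; their values for \<open>t < 0\<close> are
  irrelevant. The equation is posed in the open set \<open>(0, \<infinity>) \<times> \<real>\<^sup>3\<close>.\<close>

abbreviation spacetime :: "(real \<times> (real^3)) set" where
  "spacetime \<equiv> {0<..} \<times> UNIV"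

abbreviation spacetime0 :: "(real \<times> (real^3)) set" where
  "spacetime0 \<equiv> {0..} \<times> UNIV"

definition dt :: "(real \<times> (real^3) \<Rightarrow> 'b::real_normed_vector) \<Rightarrow> real \<times> (real^3) \<Rightarrow> 'b" where
  "dt \<phi> = dirderiv (1, 0) \<phi>"

definition dx :: "3 \<Rightarrow> (real \<times> (real^3) \<Rightarrow> 'b::real_normed_vector) \<Rightarrow> real \<times> (real^3) \<Rightarrow> 'b" where
  "dx i \<phi> = dirderiv (0, axis i 1) \<phi>"

definition laplace :: "(real \<times> (real^3) \<Rightarrow> 'b::real_normed_vector) \<Rightarrow> real \<times> (real^3) \<Rightarrow> 'b" where
  "laplace \<phi> p = (\<Sum>i\<in>UNIV. dx i (dx i \<phi>) p)"

definition grad :: "(real \<times> (real^3) \<Rightarrow> real) \<Rightarrow> real \<times> (real^3) \<Rightarrow> real^3" where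
  "grad \<psi> p = (\<chi> i. dx i \<psi> p)"

definition dive :: "(real \<times> (real^3) \<Rightarrow> real^3) \<Rightarrow> real \<times> (real^3) \<Rightarrow> real" where
  "dive \<phi> p = (\<Sum>i\<in>UNIV. dx i \<phi> p $ i)"

text \<open>The pressure \<open>Q\<close> is an arbitrary distribution, and \<open>\<partial>\<^sub>t g\<close> is a distributional derivative.
  The initial condition says that \<open>z 0 = z0\<close> and that \<open>z\<close> attains this value in the sense of
  distributions in \<open>\<real>\<^sup>3\<close> as \<open>t\<close> decreases to \<open>0\<close>. Since the momentum equation is tested in the
  open set \<open>(0, \<infinity>) \<times> \<real>\<^sup>3\<close>, no initial value of \<open>g\<close> is involved.\<close>

definition stokes_solution ::
  "(real^3 \<Rightarrow> real^3) \<Rightarrow> (real \<Rightarrow> real^3 \<Rightarrow> real^3) \<Rightarrow> (real \<Rightarrow> real^3 \<Rightarrow> real^3) \<Rightarrow>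
   (real \<Rightarrow> real^3 \<Rightarrow> real^3) \<Rightarrow> bool" where
  "stokes_solution z0 f g z \<longleftrightarrow>
     locally_integrable spacetime0 (\<lambda>(t, x). z t x) \<and>
     (\<forall>t\<ge>0. locally_integrable UNIV (z t)) \<and>
     (\<exists>Q. distribution_on spacetime Q \<and>
        (\<forall>\<phi>\<in>test_functions spacetime.
           - (\<integral>(t, x). z t x \<bullet> dt \<phi> (t, x) \<partial>lebesgue)
           - (\<integral>(t, x). z t x \<bullet> laplace \<phi> (t, x) \<partial>lebesgue)
           - Q (dive \<phi>)
           = (\<integral>(t, x). f t x \<bullet> \<phi> (t, x) \<partial>lebesgue)
             - (\<integral>(t, x). g t x \<bullet> dt \<phi> (t, x) \<partial>lebesgue))) \<and>
     (\<forall>\<psi>\<in>test_functions spacetime. (\<integral>(t, x). z t x \<bullet> grad \<psi> (t, x) \<partial>lebesgue) = 0) \<and>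
     z 0 = z0 \<and>
     (\<forall>\<psi>\<in>test_functions UNIV.
        ((\<lambda>t. \<integral>x. z t x \<bullet> \<psi> x \<partial>lebesgue) \<longlongrightarrow> (\<integral>x. z0 x \<bullet> \<psi> x \<partial>lebesgue)) (at_right 0))"

section \<open>Singular set and Hausdorff dimension\<close>

definition regular_point :: "(real \<Rightarrow> real^3 \<Rightarrow> real^3) \<Rightarrow> real \<times> (real^3) \<Rightarrow> bool" where
  "regular_point u p \<longleftrightarrow>
     (\<exists>U C. open U \<and> p \<in> U \<and> U \<subseteq> spacetime \<and>
        (AE (t, x) in lebesgue. (t, x) \<in> U \<longrightarrow> norm (u t x) \<le> C))"

definition singular_set :: "(real \<Rightarrow> real^3 \<Rightarrow> real^3) \<Rightarrow> (real \<times> (real^3)) set" where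
  "singular_set u = {p \<in> spacetime. \<not> regular_point u p}"

definition hausdorff_premeasure :: "real \<Rightarrow> real \<Rightarrow> 'a::metric_space set \<Rightarrow> ennreal" where
  "hausdorff_premeasure s \<delta> E =
     (INF U \<in> {U :: nat \<Rightarrow> 'a set.
        E \<subseteq> (\<Union>i. U i) \<and> (\<forall>i. bounded (U i) \<and> diameter (U i) \<le> \<delta>)}.
      \<Sum>i. ennreal (diameter (U i) powr s))"

definition hausdorff_measure :: "real \<Rightarrow> 'a::metric_space set \<Rightarrow> ennreal" where
  "hausdorff_measure s E = (SUP \<delta>\<in>{0<..}. hausdorff_premeasure s \<delta> E)"

text \<open>Only \<open>s > 0\<close> is used, which avoids the convention for \<open>0\<^sup>0\<close> in the counting measure and does
  not change the infimum. The metric on \<open>real \<times> (real^3)\<close> is the Euclidean one of \<open>\<real>\<^sup>4\<close>.\<close>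

definition hausdorff_dim :: "'a::metric_space set \<Rightarrow> ereal" where
  "hausdorff_dim E = (INF s \<in> {s. 0 < s \<and> hausdorff_measure s E = 0}. ereal s)"

end

(* Take g = z, f = - Laplace z, Q = 0 and z0 = 0. Then the equation holds for every solenoidal z with
   the required integrability, and no regularity of z in time is needed. Let z be piecewise constant
   in time, equal to k w((k + 1) (x - c k)) on the k-th time interval, for a fixed smooth compactly
   supported solenoidal field w. These intervals accumulate at t = 1 and get short so fast that the
   H^1 norms are square integrable, while the L^2 norms stay bounded. If the centres c k visit every
   open subset of the unit ball B infinitely often, then z is unbounded near each point of {1} x B,
   so the singular set has dimension at least 3. *)

theory Submission
  imports Defs
begin

section \<open>Smooth functions\<close>

text \<open>The obstacle is to be unbounded at every point of a three-dimensional slice with finite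
  energy. Amplitude k on a ball of radius 1 / (k + 1) costs a multiple of k^2 / (k + 1)^3 in the
  squared L^2 norm, of k^2 / (k + 1) in that of the gradient, and of k (k + 1)^2 in the sup norm of
  the Laplacian. All of these are at most a multiple of k^4, a generous common budget: for k >= 1
  the time spent at levels from k on is (k + 1)^(-8). So a single domination by (1 - t)^(-1/2)
  yields the energy bound, the local integrability of f and the use of Fubini. Jumps between levels
  are harmless because only spatial derivatives are ever moved onto z, one time slice at a time. The
  field is zero for t <= 1/2 and for t >= 1, which settles the initial condition, the compact
  support and the smoothness at the singular time itself.\<close>

lemma smooth_coinduct:
  assumes "P u"
    and "\<And>u x. P u \<Longrightarrow> u differentiable (at x)"
    and "\<And>u v. P u \<Longrightarrow> P (dirderiv v u)"
  shows "smooth u"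
proof -
  \<comment> \<open>\<open>fold\<close> differentiates in the direction at the head of the list
    first, so induction with \<open>u\<close> arbitrary keeps every iterated derivative in
    \<open>P\<close>. Smoothness proofs thus reduce to finding a class of functions stable under one
    derivative.\<close>
  have "P (fold dirderiv vs u)" if "P u" for vs u
    using that by (induction vs arbitrary: u) (auto intro: assms(3))
  then show ?thesis
    using assms(1,2) by (auto simp: smooth_def)
qed

lemma smooth_differentiable: "smooth u \<Longrightarrow> u differentiable (at x)"
  unfolding smooth_def by (metis fold_simps(1))

lemma smooth_dirderiv: "smooth u \<Longrightarrow> smooth (dirderiv v u)"
  unfolding smooth_def by (metis fold_simps(2))

lemma smooth_continuous_on: "smooth u \<Longrightarrow> continuous_on S u"
  by (meson smooth_differentiable continuous_at_imp_continuous_on differentiable_imp_continuous_within)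

lemma dirderiv_eq: "(u has_derivative D) (at x) \<Longrightarrow> dirderiv v u x = D v"
  unfolding dirderiv_def using frechet_derivative_at by metis

lemma smooth_has_derivative:
  "smooth u \<Longrightarrow> (u has_derivative (\<lambda>v. dirderiv v u x)) (at x)"
  unfolding dirderiv_def using smooth_differentiable frechet_derivative_works by blast

lemma smooth_affine:
  fixes u :: "'a::euclidean_space \<Rightarrow> 'b::real_normed_vector"
  assumes "smooth u"
  shows "smooth (\<lambda>x. a *\<^sub>R u (m *\<^sub>R (x - c)))"
    and "dirderiv v (\<lambda>x. a *\<^sub>R u (m *\<^sub>R (x - c))) = (\<lambda>x. (a * m) *\<^sub>R dirderiv v u (m *\<^sub>R (x - c)))"
proof -
  have D: "((\<lambda>x. a *\<^sub>R u (m *\<^sub>R (x - c))) has_derivative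
      (\<lambda>v. a *\<^sub>R dirderiv (m *\<^sub>R v) u (m *\<^sub>R (x - c)))) (at x)" if "smooth u"
    for a and u :: "'a \<Rightarrow> 'b" and x
  proof -
    have "((\<lambda>x. m *\<^sub>R (x - c)) has_derivative (\<lambda>v. m *\<^sub>R v)) (at x)"
      by (auto intro!: derivative_eq_intros)
    from has_derivative_compose[OF this smooth_has_derivative[OF that]]
    show ?thesis by (rule has_derivative_scaleR_right)
  qed
  have lin: "dirderiv (m *\<^sub>R v) u y = m *\<^sub>R dirderiv v u y" if "smooth u"
    for u :: "'a \<Rightarrow> 'b" and v y
    using linear_cmul[OF has_derivative_linear[OF smooth_has_derivative[OF that]]] .
  have E: "dirderiv v (\<lambda>x. a *\<^sub>R u (m *\<^sub>R (x - c))) = (\<lambda>x. (a * m) *\<^sub>R dirderiv v u (m *\<^sub>R (x - c)))"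
    if "smooth u" for a and u :: "'a \<Rightarrow> 'b" and v
    using dirderiv_eq[OF D[OF that]] lin[OF that] by (auto simp: fun_eq_iff)
  show "dirderiv v (\<lambda>x. a *\<^sub>R u (m *\<^sub>R (x - c))) = (\<lambda>x. (a * m) *\<^sub>R dirderiv v u (m *\<^sub>R (x - c)))"
    by (rule E[OF assms])
  \<comment> \<open>The class leaves \<open>a\<close> and \<open>u\<close> free, since a derivative
    replaces them by \<open>a * m\<close> and a derivative of \<open>u\<close>, while
    \<open>m\<close> and \<open>c\<close> stay fixed.\<close>
  show "smooth (\<lambda>x. a *\<^sub>R u (m *\<^sub>R (x - c)))"
  proof (rule smooth_coinduct[where P = "\<lambda>w. \<exists>a u. smooth u \<and> w = (\<lambda>x. a *\<^sub>R u (m *\<^sub>R (x - c)))"])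
    show "\<exists>a' u'. smooth u' \<and> (\<lambda>x. a *\<^sub>R u (m *\<^sub>R (x - c))) = (\<lambda>x. a' *\<^sub>R u' (m *\<^sub>R (x - c)))"
      using assms by blast
  next
    fix w :: "'a \<Rightarrow> 'b" and x assume "\<exists>a u. smooth u \<and> w = (\<lambda>x. a *\<^sub>R u (m *\<^sub>R (x - c)))"
    then show "w differentiable (at x)" using D unfolding differentiable_def by blast
  next
    fix w :: "'a \<Rightarrow> 'b" and v assume "\<exists>a u. smooth u \<and> w = (\<lambda>x. a *\<^sub>R u (m *\<^sub>R (x - c)))"
    then show "\<exists>a u. smooth u \<and> dirderiv v w = (\<lambda>x. a *\<^sub>R u (m *\<^sub>R (x - c)))"
      using E smooth_dirderiv by metis
  qed
qed

text \<open>Links derivatives of a space-time test function in directions \<open>(0, v)\<close> with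
  derivatives of its time slices, so that integration by parts can take place in space at fixed
  time.\<close>

lemma smooth_slice:
  fixes \<phi> :: "'c::euclidean_space \<times> 'a::euclidean_space \<Rightarrow> 'b::real_normed_vector"
  assumes "smooth \<phi>"
  shows "smooth (\<lambda>x. \<phi> (t, x))"
    and "dirderiv v (\<lambda>x. \<phi> (t, x)) = (\<lambda>x. dirderiv (0, v) \<phi> (t, x))"
proof -
  have D: "((\<lambda>x. \<phi> (t, x)) has_derivative (\<lambda>v. dirderiv (0, v) \<phi> (t, x))) (at x)"
    if "smooth \<phi>" for \<phi> :: "'c \<times> 'a \<Rightarrow> 'b" and x
  proof -
    have "((\<lambda>x. (t, x)) has_derivative (\<lambda>v. (0, v))) (at x)"
      by (auto intro!: derivative_eq_intros)
    from has_derivative_compose[OF this smooth_has_derivative[OF that]] show ?thesis .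
  qed
  show "dirderiv v (\<lambda>x. \<phi> (t, x)) = (\<lambda>x. dirderiv (0, v) \<phi> (t, x))"
    using dirderiv_eq[OF D[OF assms]] by auto
  show "smooth (\<lambda>x. \<phi> (t, x))"
  proof (rule smooth_coinduct[where P = "\<lambda>w. \<exists>\<phi>. smooth \<phi> \<and> w = (\<lambda>x. \<phi> (t, x))"])
    show "\<exists>\<phi>'. smooth \<phi>' \<and> (\<lambda>x. \<phi> (t, x)) = (\<lambda>x. \<phi>' (t, x))"
      using assms by blast
  next
    fix w :: "'a \<Rightarrow> 'b" and x assume "\<exists>\<phi>. smooth \<phi> \<and> w = (\<lambda>x. \<phi> (t, x))"
    then show "w differentiable (at x)" using D unfolding differentiable_def by blast
  next
    fix w :: "'a \<Rightarrow> 'b" and v assume "\<exists>\<phi>. smooth \<phi> \<and> w = (\<lambda>x. \<phi> (t, x))"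
    then obtain \<phi> where "smooth \<phi>" "w = (\<lambda>x. \<phi> (t, x))" by blast
    then have "dirderiv v w = (\<lambda>x. dirderiv (0, v) \<phi> (t, x))"
      using dirderiv_eq[OF D] by auto
    then show "\<exists>\<phi>. smooth \<phi> \<and> dirderiv v w = (\<lambda>x. \<phi> (t, x))"
      using smooth_dirderiv[OF \<open>smooth \<phi>\<close>] by blast
  qed
qed

lemma smooth_vec:
  fixes h :: "'n::finite \<Rightarrow> 'a::euclidean_space \<Rightarrow> real"
  assumes "\<And>i. smooth (h i)"
  shows "smooth (\<lambda>x. \<chi> i. h i x)"
    and "dirderiv v (\<lambda>x. \<chi> i. h i x) = (\<lambda>x. \<chi> i. dirderiv v (h i) x)"
proof -
  have D: "((\<lambda>x. \<chi> i. h i x) has_derivative (\<lambda>v. \<chi> i. dirderiv v (h i) x)) (at x)"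
    if "\<And>i. smooth (h i)" for h :: "'n \<Rightarrow> 'a \<Rightarrow> real" and x
  proof -
    have "((\<lambda>x. \<Sum>i\<in>UNIV. h i x *\<^sub>R axis i 1) has_derivative
        (\<lambda>v. \<Sum>i\<in>UNIV. dirderiv v (h i) x *\<^sub>R (axis i 1 :: real^'n))) (at x)"
      by (intro derivative_intros has_derivative_scaleR_left smooth_has_derivative that)
    moreover have "(\<Sum>i\<in>UNIV. a i *\<^sub>R axis i 1) = (\<chi> i. a i)" for a :: "'n \<Rightarrow> real"
      by (simp add: vec_eq_iff axis_def if_distrib cong: if_cong)
    ultimately show ?thesis by simp
  qed
  show "dirderiv v (\<lambda>x. \<chi> i. h i x) = (\<lambda>x. \<chi> i. dirderiv v (h i) x)"
    using dirderiv_eq[OF D[OF assms]] by auto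
  show "smooth (\<lambda>x. \<chi> i. h i x)"
  proof (rule smooth_coinduct[where P = "\<lambda>w. \<exists>h. (\<forall>i. smooth (h i)) \<and> w = (\<lambda>x. \<chi> i. h i x)"])
    show "\<exists>h'. (\<forall>i. smooth (h' i)) \<and> (\<lambda>x. \<chi> i. h i x) = (\<lambda>x. \<chi> i. h' i x)"
      using assms by blast
  next
    fix w :: "'a \<Rightarrow> real^'n" and x
    assume "\<exists>h. (\<forall>i. smooth (h i)) \<and> w = (\<lambda>x. \<chi> i. h i x)"
    then show "w differentiable (at x)" using D unfolding differentiable_def by blast
  next
    fix w :: "'a \<Rightarrow> real^'n" and v
    assume "\<exists>h. (\<forall>i. smooth (h i)) \<and> w = (\<lambda>x. \<chi> i. h i x)"
    then obtain h where h: "\<And>i. smooth (h i)" "w = (\<lambda>x. \<chi> i. h i x)" by blast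
    then have "dirderiv v w = (\<lambda>x. \<chi> i. dirderiv v (h i) x)"
      using dirderiv_eq[OF D[OF h(1)]] by auto
    then show "\<exists>h. (\<forall>i. smooth (h i)) \<and> dirderiv v w = (\<lambda>x. \<chi> i. h i x)"
      using smooth_dirderiv[OF h(1)] by (intro exI[of _ "\<lambda>i. dirderiv v (h i)"]) auto
  qed
qed

lemma smooth_component:
  fixes u :: "'a::euclidean_space \<Rightarrow> real^'n"
  assumes "smooth u"
  shows "smooth (\<lambda>x. u x $ i)"
    and "dirderiv v (\<lambda>x. u x $ i) = (\<lambda>x. dirderiv v u x $ i)"
proof -
  have D: "((\<lambda>x. u x $ i) has_derivative (\<lambda>v. dirderiv v u x $ i)) (at x)"
    if "smooth u" for u :: "'a \<Rightarrow> real^'n" and x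
    by (rule bounded_linear.has_derivative[OF bounded_linear_vec_nth smooth_has_derivative[OF that]])
  show "dirderiv v (\<lambda>x. u x $ i) = (\<lambda>x. dirderiv v u x $ i)"
    using dirderiv_eq[OF D[OF assms]] by auto
  show "smooth (\<lambda>x. u x $ i)"
  proof (rule smooth_coinduct[where P = "\<lambda>w. \<exists>u. smooth u \<and> w = (\<lambda>x. u x $ i)"])
    show "\<exists>u'. smooth u' \<and> (\<lambda>x. u x $ i) = (\<lambda>x. u' x $ i)"
      using assms by blast
  next
    fix w :: "'a \<Rightarrow> real" and x assume "\<exists>u. smooth u \<and> w = (\<lambda>x. u x $ i)"
    then show "w differentiable (at x)" using D unfolding differentiable_def by blast
  next
    fix w :: "'a \<Rightarrow> real" and v assume "\<exists>u. smooth u \<and> w = (\<lambda>x. u x $ i)"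
    then obtain u where u: "smooth u" "w = (\<lambda>x. u x $ i)" by blast
    then have "dirderiv v w = (\<lambda>x. dirderiv v u x $ i)"
      using dirderiv_eq[OF D[OF u(1)]] by auto
    then show "\<exists>u. smooth u \<and> dirderiv v w = (\<lambda>x. u x $ i)"
      using smooth_dirderiv[OF u(1)] by blast
  qed
qed

text \<open>The complement of \<open>S\<close> is open, so \<open>u\<close> is zero near
  \<open>x\<close>. Derivatives of any order therefore keep the support ball of the original
  field.\<close>

lemma dirderiv_zero_off:
  assumes "closed S" "\<And>x. x \<notin> S \<Longrightarrow> u x = 0" "x \<notin> S"
  shows "dirderiv v u x = 0"
proof -
  have "(u has_derivative (\<lambda>v. 0)) (at x)"
    by (rule has_derivative_transform_within_open[where s = "- S" and f = "\<lambda>x. 0"])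
      (use assms in auto)
  then show ?thesis by (rule dirderiv_eq)
qed

section \<open>A smooth compactly supported solenoidal field\<close>

text \<open>\<open>flat 0\<close> is the classical cutoff exp(-1/s). The powers of 1/s are included
  so that derivatives are linear combinations of members of the family.\<close>

definition flat :: "nat \<Rightarrow> real \<Rightarrow> real" where
  "flat n s = (if s > 0 then exp (- 1 / s) / s ^ n else 0)"

text \<open>This is the difference quotient of \<open>flat n\<close> at 0. On the right, y = 1/s
  turns it into y^(n + 1) / exp y; on the left it is zero.\<close>

lemma flat_div_tendsto_0: "((\<lambda>s. flat n s / s) \<longlongrightarrow> 0) (at 0)"
proof -
  have "((\<lambda>s::real. inverse s ^ Suc n / exp (inverse s)) \<longlongrightarrow> 0) (at_right 0)"
    by (rule filterlim_compose[OF tendsto_power_div_exp_0 filterlim_inverse_at_top_right])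
  then have "((\<lambda>s. flat n s / s) \<longlongrightarrow> 0) (at_right 0)"
    by (rule Lim_transform_eventually)
      (auto simp: eventually_at_right_field flat_def exp_minus field_simps intro!: exI[of _ 1])
  moreover have "((\<lambda>s. flat n s / s) \<longlongrightarrow> 0) (at_left 0)"
    by (rule Lim_transform_eventually[OF tendsto_const])
      (auto simp: eventually_at_left_field flat_def intro!: exI[of _ "-1"])
  ultimately show ?thesis
    using filterlim_split_at by blast
qed

lemma flat_DERIV:
  "(flat n has_real_derivative (flat (n + 2) s - n * flat (n + 1) s)) (at s)"
proof (cases s "0::real" rule: linorder_cases)
  case less
  have "((\<lambda>s. 0) has_real_derivative 0) (at s)" by simp
  then have "(flat n has_real_derivative 0) (at s)"
    by (rule has_field_derivative_transform_within_open[where S = "{..<0}"]) (use less in \<open>auto simp: flat_def\<close>)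
  with less show ?thesis by (simp add: flat_def)
next
  case equal
  then show ?thesis
    using flat_div_tendsto_0[of n] by (simp add: has_field_derivative_iff flat_def)
next
  case greater
  have "((\<lambda>s. exp (- 1 / s) / s ^ n) has_real_derivative
      (exp (- 1 / s) * (1 / s^2) * s ^ n - exp (- 1 / s) * (n * s ^ (n - 1))) / (s ^ n * s ^ n)) (at s)"
    using greater by (auto intro!: derivative_eq_intros simp: power2_eq_square)
  also have "(exp (- 1 / s) * (1 / s^2) * s ^ n - exp (- 1 / s) * (n * s ^ (n - 1))) / (s ^ n * s ^ n)
      = flat (n + 2) s - n * flat (n + 1) s"
    \<comment> \<open>The case \<open>n = 0\<close> is separate because \<open>n - 1\<close> is a
      truncated difference.\<close>
    using greater by (cases n) (auto simp: flat_def field_simps power2_eq_square)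
  finally show ?thesis
    by (rule has_field_derivative_transform_within_open[where S = "{0<..}"]) (use greater in \<open>auto simp: flat_def\<close>)
qed

text \<open>The algebra generated by the linear functionals and closed under composition with
  \<open>flat n\<close> is stable under directional derivatives, so its members are smooth.\<close>

inductive flat_algebra :: "('a::euclidean_space \<Rightarrow> real) \<Rightarrow> bool" where
  const: "flat_algebra (\<lambda>x. a)"
| linear: "flat_algebra (\<lambda>x. x \<bullet> b)"
| add: "flat_algebra p \<Longrightarrow> flat_algebra q \<Longrightarrow> flat_algebra (\<lambda>x. p x + q x)"
| mult: "flat_algebra p \<Longrightarrow> flat_algebra q \<Longrightarrow> flat_algebra (\<lambda>x. p x * q x)"
| flat: "flat_algebra p \<Longrightarrow> flat_algebra (\<lambda>x. flat n (p x))"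

lemma flat_algebra_derivative:
  assumes "flat_algebra u"
  shows "\<exists>D. (\<forall>x. (u has_derivative (\<lambda>v. D v x)) (at x)) \<and> (\<forall>v. flat_algebra (D v))"
  using assms
proof induction
  case (const a)
  show ?case
    by (rule exI[of _ "\<lambda>v x. 0"]) (auto intro: flat_algebra.const)
next
  case (linear b)
  show ?case
    by (rule exI[of _ "\<lambda>v x. v \<bullet> b"])
      (auto intro!: flat_algebra.const derivative_eq_intros)
next
  case (add p q)
  then obtain P Q where "\<forall>x. (p has_derivative (\<lambda>v. P v x)) (at x)" "\<forall>v. flat_algebra (P v)"
    "\<forall>x. (q has_derivative (\<lambda>v. Q v x)) (at x)" "\<forall>v. flat_algebra (Q v)" by blast
  then show ?case
    by (intro exI[of _ "\<lambda>v x. P v x + Q v x"]) (auto intro: flat_algebra.add has_derivative_add)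
next
  case (mult p q)
  then obtain P Q where "\<forall>x. (p has_derivative (\<lambda>v. P v x)) (at x)" "\<forall>v. flat_algebra (P v)"
    "\<forall>x. (q has_derivative (\<lambda>v. Q v x)) (at x)" "\<forall>v. flat_algebra (Q v)" by blast
  then show ?case using mult.hyps
    by (intro exI[of _ "\<lambda>v x. p x * Q v x + P v x * q x"])
      (intro conjI allI has_derivative_mult flat_algebra.add flat_algebra.mult; blast)
next
  case (flat p n)
  then obtain P where P: "\<And>x. (p has_derivative (\<lambda>v. P v x)) (at x)" "\<And>v. flat_algebra (P v)"
    by blast
  have "((\<lambda>x. flat n (p x)) has_derivative
      (\<lambda>v. (flat (n + 2) (p x) + - real n * flat (n + 1) (p x)) * P v x)) (at x)" for x
    using has_derivative_compose[OF P(1) flat_DERIV[THEN has_field_derivative_imp_has_derivative]]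
    by simp
  with P(2) flat.hyps show ?case
    by (intro exI[of _ "\<lambda>v x. (flat (n + 2) (p x) + - real n * flat (n + 1) (p x)) * P v x"])
      (intro conjI allI flat_algebra.intros; blast)
qed

lemma smooth_flat_algebra:
  assumes "flat_algebra u"
  shows "smooth u"
proof (rule smooth_coinduct[where P = flat_algebra])
  fix u :: "'a \<Rightarrow> real" and x v
  assume "flat_algebra u"
  then obtain D where D: "\<And>x. (u has_derivative (\<lambda>v. D v x)) (at x)" "\<And>v. flat_algebra (D v)"
    using flat_algebra_derivative by blast
  show "u differentiable (at x)"
    using D(1) unfolding differentiable_def by blast
  have "dirderiv v u = D v"
    using dirderiv_eq[OF D(1)] by auto
  then show "flat_algebra (dirderiv v u)"
    using D(2) by simp
qed (fact assms)

text \<open>The field with components \<open>x \<bullet> rot i\<close> is (x2, -x1, 0), a rotation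
  about the third axis. This form makes each component a linear functional, hence a member of
  \<open>flat_algebra\<close>.\<close>

definition rot :: "3 \<Rightarrow> real^3" where
  "rot i = (if i = 1 then axis 2 1 else if i = 2 then - axis 1 1 else 0)"

definition swirl :: "real^3 \<Rightarrow> real^3" where
  "swirl x = (\<chi> i. flat 0 (1 - x \<bullet> x) * (x \<bullet> rot i))"

lemma flat_algebra_swirl: "flat_algebra (\<lambda>x::real^3. flat 0 (1 - x \<bullet> x) * (x \<bullet> rot i))"
proof -
  \<comment> \<open>Rewritten with sums, products, constants and coordinates only, to match the
    constructors of \<open>flat_algebra\<close>.\<close>
  have *: "1 - x \<bullet> x = 1 + (-1 * (x$1 * x$1) + (-1 * (x$2 * x$2) + -1 * (x$3 * x$3)))" for x :: "real^3"
    by (simp add: inner_vec_def sum_3)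
  have c: "flat_algebra (\<lambda>x::real^3. x $ j)" for j :: 3
    using flat_algebra.linear[of "axis j (1::real)"] by (simp add: inner_axis)
  show ?thesis
    unfolding * by (intro flat_algebra.intros c)
qed

lemma smooth_swirl: "smooth swirl"
  unfolding swirl_def by (intro smooth_vec(1) smooth_flat_algebra flat_algebra_swirl)

lemma swirl_eq_0: "x \<notin> cball 0 1 \<Longrightarrow> swirl x = 0"
proof -
  assume "x \<notin> cball 0 1"
  then have "x \<bullet> x > 1" by (simp flip: power2_norm_eq_inner)
  then show ?thesis by (simp add: swirl_def flat_def vec_eq_iff)
qed

text \<open>The swirl vanishes on its axis, in particular at its centre, so the point where a bubble
  is large must lie off the axis.\<close>

lemma swirl_nonzero: "swirl (axis 1 (1/2)) \<noteq> 0"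
proof -
  have "swirl (axis 1 (1/2)) $ 2 \<noteq> 0"
    by (simp add: swirl_def flat_def rot_def inner_vec_def sum_3 axis_def)
  then show ?thesis by (metis zero_index)
qed

text \<open>The rotation field is divergence free, and the gradient of the radial factor is parallel
  to \<open>x\<close>, hence orthogonal to the rotation field.\<close>

lemma div_swirl: "(\<Sum>i\<in>UNIV. dirderiv (axis i 1) swirl x $ i) = 0"
proof -
  \<comment> \<open>\<open>E\<close> is the derivative of \<open>flat 0\<close> at
    \<open>1 - x \<bullet> x\<close>: for \<open>n = 0\<close> only the term
    \<open>flat (n + 2)\<close> of the derivative survives.\<close>
  define E where "E = flat 2 (1 - x \<bullet> x)"
  have *: "((\<lambda>x. flat 0 (1 - x \<bullet> x) * (x \<bullet> rot i)) has_derivative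
     (\<lambda>v. flat 0 (1 - x \<bullet> x) * (v \<bullet> rot i) + (E * - (x \<bullet> v + v \<bullet> x)) * (x \<bullet> rot i))) (at x)" for i
  proof -
    have "((\<lambda>x. 1 - x \<bullet> x) has_derivative (\<lambda>v. - (x \<bullet> v + v \<bullet> x))) (at x)"
      by (auto intro!: derivative_eq_intros)
    from has_derivative_compose[OF this flat_DERIV[THEN has_field_derivative_imp_has_derivative], of 0]
    have 1: "((\<lambda>x. flat 0 (1 - x \<bullet> x)) has_derivative (\<lambda>v. E * - (x \<bullet> v + v \<bullet> x))) (at x)"
      by (simp add: E_def numeral_2_eq_2)
    have 2: "((\<lambda>x. x \<bullet> rot i) has_derivative (\<lambda>v. v \<bullet> rot i)) (at x)"
      by (auto intro!: derivative_eq_intros)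
    show ?thesis
      using has_derivative_mult[OF 1 2] .
  qed
  have D: "dirderiv v swirl x $ i =
     flat 0 (1 - x \<bullet> x) * (v \<bullet> rot i) + (E * - (x \<bullet> v + v \<bullet> x)) * (x \<bullet> rot i)" for v i
    unfolding swirl_def smooth_vec(2)[OF smooth_flat_algebra[OF flat_algebra_swirl]]
    using dirderiv_eq[OF *] by simp
  show ?thesis
    by (simp only: sum_3 D) (simp add: rot_def inner_vec_def sum_3 axis_def algebra_simps)
qed

section \<open>Integration by parts\<close>

lemma integrable_bounded_support:
  fixes f :: "'a::euclidean_space \<Rightarrow> 'b::euclidean_space"
  assumes "continuous_on UNIV f" "\<And>x. x \<notin> cball 0 R \<Longrightarrow> f x = 0"
  shows "integrable lborel f"
proof -
  have "integrable lborel (\<lambda>x. indicator (cball 0 R) x *\<^sub>R f x)"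
    using assms(1) continuous_on_subset by (intro borel_integrable_compact) auto
  also have "(\<lambda>x. indicator (cball 0 R) x *\<^sub>R f x) = f"
    using assms(2) by (auto simp: indicator_def fun_eq_iff)
  finally show ?thesis .
qed

lemma bounded_bounded_support:
  fixes f :: "'a::euclidean_space \<Rightarrow> 'b::euclidean_space"
  assumes "continuous_on UNIV f" "\<And>x. x \<notin> cball 0 R \<Longrightarrow> f x = 0"
  obtains B where "B \<ge> 0" "\<And>x. norm (f x) \<le> B"
proof -
  have "bounded (f ` cball 0 R)"
    using assms(1) continuous_on_subset
    by (intro compact_imp_bounded compact_continuous_image) auto
  then obtain B where "B > 0" and B: "\<And>x. x \<in> cball 0 R \<Longrightarrow> norm (f x) \<le> B"
    by (auto simp: bounded_pos)
  show ?thesis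
    by (rule that[of B]) (use \<open>B > 0\<close> B assms(2) in \<open>force+\<close>)
qed

text \<open>The integrals of the difference quotients vanish by translation invariance.\<close>

lemma integral_derivative_eq_0:
  fixes F :: "'a::euclidean_space \<Rightarrow> real"
  assumes D: "\<And>x. (F has_derivative F' x) (at x)"
    and cont: "continuous_on UNIV (\<lambda>x. F' x v)"
    and supp: "\<And>x. x \<notin> cball 0 R \<Longrightarrow> F x = 0"
  shows "(\<integral>x. F' x v \<partial>lborel) = 0"
proof -
  have contF: "continuous_on UNIV F"
    by (intro continuous_at_imp_continuous_on ballI has_derivative_continuous[OF D])
  have intF: "integrable lborel F"
    by (rule integrable_bounded_support[OF contF supp])
  have "F' x v = 0" if "x \<notin> cball 0 R" for x
    using dirderiv_zero_off[where u = F and v = v, OF closed_cball supp that]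
    by (simp add: dirderiv_eq[OF D])
  from bounded_bounded_support[OF cont this]
  obtain B where B: "B \<ge> 0" "\<And>x. norm (F' x v) \<le> B" by blast
  define h where "h n = inverse (real (Suc n))" for n
  have h: "0 < h n" "h n \<le> 1" for n
    by (auto simp: h_def field_simps)
  define q where "q n x = (F (x + h n *\<^sub>R v) - F x) / h n" for n x
  have line: "((\<lambda>s. F (x + s *\<^sub>R v)) has_real_derivative F' (x + s *\<^sub>R v) v) (at s)" for x s
  proof -
    have "((\<lambda>s. x + s *\<^sub>R v) has_derivative (\<lambda>r. r *\<^sub>R v)) (at s)"
      by (auto intro!: derivative_eq_intros)
    from has_derivative_compose[OF this D]
    have "((\<lambda>s. F (x + s *\<^sub>R v)) has_derivative (\<lambda>r. F' (x + s *\<^sub>R v) (r *\<^sub>R v))) (at s)" .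
    moreover have "F' y (r *\<^sub>R v) = F' y v * r" for y r
      using linear_cmul[OF has_derivative_linear[OF D]] by simp
    ultimately show ?thesis
      by (simp add: has_field_derivative_def)
  qed
  have int0: "(\<integral>x. q n x \<partial>lborel) = 0" for n
  proof -
    have "integrable (distr lborel borel ((+) (h n *\<^sub>R v))) F"
      using intF by (simp add: lborel_distr_plus)
    then have i: "integrable lborel (\<lambda>x. F (h n *\<^sub>R v + x))"
      by (subst (asm) integrable_distr_eq) (auto intro: borel_measurable_continuous_onI contF)
    have "(\<integral>x. F x \<partial>distr lborel borel ((+) (h n *\<^sub>R v))) = (\<integral>x. F (h n *\<^sub>R v + x) \<partial>lborel)"
      by (rule integral_distr) (auto intro: borel_measurable_continuous_onI contF)
    then have "(\<integral>x. F (h n *\<^sub>R v + x) \<partial>lborel) = (\<integral>x. F x \<partial>lborel)"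
      by (simp add: lborel_distr_plus)
    with i intF show ?thesis
      by (simp add: q_def add.commute)
  qed
  have "(\<lambda>n. \<integral>x. q n x \<partial>lborel) \<longlonglongrightarrow> (\<integral>x. F' x v \<partial>lborel)"
  \<comment> \<open>Since \<open>h n \<le> 1\<close>, all quotients vanish outside the ball of
    radius \<open>R + norm v\<close>; the mean value theorem bounds them by
    \<open>B\<close>.\<close>
  proof (rule integral_dominated_convergence[where w = "\<lambda>x. indicator (cball 0 (R + norm v)) x *\<^sub>R B"])
    show "(\<lambda>x. F' x v) \<in> borel_measurable lborel"
      using cont by (simp add: borel_measurable_continuous_onI)
    have "q n \<in> borel_measurable borel" for n
      unfolding q_def
      by (intro borel_measurable_continuous_onI continuous_intros continuous_on_compose2[OF contF])
        (use h[of n] in auto)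
    then show "q n \<in> borel_measurable lborel" for n by simp
    show "integrable lborel (\<lambda>x. indicator (cball 0 (R + norm v)) x *\<^sub>R B)"
      by (intro borel_integrable_compact) auto
    show "AE x in lborel. (\<lambda>n. q n x) \<longlonglongrightarrow> F' x v"
    proof (rule AE_I2)
      fix x
      have "((\<lambda>s. (F (x + s *\<^sub>R v) - F x) / s) \<longlongrightarrow> F' x v) (at 0)"
        using line[of x 0] by (simp add: has_field_derivative_iff)
      moreover have "filterlim h (at 0) sequentially"
        using h(1) LIMSEQ_inverse_real_of_nat unfolding h_def
        by (auto simp: filterlim_at)
      ultimately show "(\<lambda>n. q n x) \<longlonglongrightarrow> F' x v"
        unfolding q_def by (rule filterlim_compose)
    qed
    fix n
    have "norm (q n x) \<le> indicator (cball 0 (R + norm v)) x *\<^sub>R B" for x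
    proof (cases "x \<in> cball 0 (R + norm v)")
      case True
      obtain s where "F (x + h n *\<^sub>R v) - F (x + 0 *\<^sub>R v) = (h n - 0) * F' (x + s *\<^sub>R v) v"
        using MVT2[OF h(1)[of n], of "\<lambda>s. F (x + s *\<^sub>R v)" "\<lambda>s. F' (x + s *\<^sub>R v) v"] line by blast
      then have "q n x = F' (x + s *\<^sub>R v) v"
        using h(1)[of n] by (simp add: q_def)
      with True B(2) show ?thesis by simp
    next
      case False
      have "norm x - norm v \<le> norm (x + h n *\<^sub>R v)"
      proof -
        have "norm (h n *\<^sub>R v) \<le> norm v"
          using h[of n] by (simp add: mult_left_le_one_le)
        then show ?thesis
          using norm_diff_ineq[of x "h n *\<^sub>R v"] by linarith
      qed
      with False have "F (x + h n *\<^sub>R v) = 0" "F x = 0"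
        by (auto intro!: supp simp: not_le) (use norm_ge_zero[of v] in linarith)
      with False show ?thesis by (simp add: q_def)
    qed
    then show "AE x in lborel. norm (q n x) \<le> indicator (cball 0 (R + norm v)) x *\<^sub>R B"
      by simp
  qed
  then show ?thesis
    by (simp add: int0 LIMSEQ_const_iff)
qed

lemma integral_inner_dirderiv:
  fixes u w :: "'a::euclidean_space \<Rightarrow> 'b::euclidean_space"
  assumes "smooth u" "smooth w" and supp: "\<And>x. x \<notin> cball 0 R \<Longrightarrow> u x = 0"
  shows "(\<integral>x. u x \<bullet> dirderiv v w x \<partial>lborel) = - (\<integral>x. dirderiv v u x \<bullet> w x \<partial>lborel)"
proof -
  note [continuous_intros] = smooth_continuous_on[OF assms(1)] smooth_continuous_on[OF assms(2)]
    smooth_continuous_on[OF smooth_dirderiv[OF assms(1)]] smooth_continuous_on[OF smooth_dirderiv[OF assms(2)]]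
  have 1: "integrable lborel (\<lambda>x. u x \<bullet> dirderiv v w x)"
    by (rule integrable_bounded_support[where R = R]) (auto intro!: continuous_intros simp: supp)
  have z: "dirderiv v u x = 0" if "x \<notin> cball 0 R" for x
    by (rule dirderiv_zero_off[OF closed_cball supp that])
  have 2: "integrable lborel (\<lambda>x. dirderiv v u x \<bullet> w x)"
    by (rule integrable_bounded_support[where R = R]) (auto intro!: continuous_intros simp: z)
  have "(\<integral>x. u x \<bullet> dirderiv v w x + dirderiv v u x \<bullet> w x \<partial>lborel) = 0"
  proof (rule integral_derivative_eq_0)
    show "((\<lambda>x. u x \<bullet> w x) has_derivative (\<lambda>v. u x \<bullet> dirderiv v w x + dirderiv v u x \<bullet> w x)) (at x)" for x
      by (rule has_derivative_inner[OF smooth_has_derivative[OF assms(1)] smooth_has_derivative[OF assms(2)]])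
    show "continuous_on UNIV (\<lambda>x. u x \<bullet> dirderiv v w x + dirderiv v u x \<bullet> w x)"
      by (intro continuous_intros)
    show "u x \<bullet> w x = 0" if "x \<notin> cball 0 R" for x
      using supp[OF that] by simp
  qed
  then show ?thesis
    using 1 2 by simp
qed

section \<open>Fields that are piecewise constant in time\<close>

text \<open>The exponent 1/8 is chosen so that the fourth power of the level is at most (1 -
  t)^(-1/2). Subtracting 1 makes the level vanish for t < 1 - 2^(-8), and the value 0 from t = 1 on
  switches the field off.\<close>

definition level :: "real \<Rightarrow> nat" where
  "level t = (if t < 1 then nat \<lfloor>(1 - t) powr (- 1 / 8)\<rfloor> - 1 else 0)"

lemma level_measurable [measurable]: "level \<in> borel \<rightarrow>\<^sub>M count_space UNIV"
  unfolding level_def by measurable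

text \<open>Here 2^(1/8) < 2 keeps the floor below 2. The field is thus zero near the initial time,
  where the initial condition becomes trivial.\<close>

lemma level_eq_0: "t \<le> 1 / 2 \<Longrightarrow> level t = 0"
proof -
  assume "t \<le> 1 / 2"
  then have "(1 - t) powr (- 1 / 8) \<le> (1 / 2) powr (- 1 / 8)"
    by (intro powr_mono2') auto
  also have "\<dots> = 2 powr (1 / 8)"
    by (simp add: powr_divide powr_minus_divide)
  also have "\<dots> < 2 powr 1"
    by (intro powr_less_mono) auto
  finally have "\<lfloor>(1 - t) powr (- 1 / 8)\<rfloor> < 2"
    by (simp add: floor_less_iff)
  then have "nat \<lfloor>(1 - t) powr (- 1 / 8)\<rfloor> - 1 = 0"
    by arith
  then show ?thesis
    by (simp add: level_def)
qed

text \<open>Written as a function of \<open>1 - t\<close>, so that integrability follows by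
  reflection from that of x^(-1/2) on [0, 1].\<close>

definition weight :: "real \<Rightarrow> real" where
  "weight t = indicator {0..1} (1 - t) * (1 - t) powr (- 1 / 2)"

lemma weight_measurable [measurable]: "weight \<in> borel_measurable borel"
  unfolding weight_def by measurable

lemma weight_nonneg: "0 \<le> weight t"
  by (simp add: weight_def)

lemma integrable_weight: "integrable lborel weight"
proof -
  have "(\<lambda>x::real. x powr (- 1 / 2)) integrable_on {0..1}"
    using has_integral_powr_from_0[of "- 1 / 2" 1] by auto
  then have "(\<lambda>x::real. x powr (- 1 / 2)) absolutely_integrable_on {0..1}"
    by (rule nonnegative_absolutely_integrable_1) auto
  then have "integrable lborel (\<lambda>x::real. indicator {0..1} x *\<^sub>R x powr (- 1 / 2))"
    unfolding set_integrable_def by (subst (asm) integrable_completion) auto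
  from lborel_integrable_real_affine[OF this, of "- 1" 1] show ?thesis
    by (simp add: weight_def[abs_def])
qed

lemma level_power_le_weight: "real (level t) ^ 4 \<le> weight t"
proof (cases "0 < t \<and> t < 1")
  case True
  have "real (level t) \<le> (1 - t) powr (- 1 / 8)"
    using True of_nat_floor[of "(1 - t) powr (- 1 / 8)"]
    unfolding level_def by (auto intro: order_trans[OF of_nat_mono[OF diff_le_self]])
  then have "real (level t) ^ 4 \<le> ((1 - t) powr (- 1 / 8)) ^ 4"
    by (rule power_mono) simp
  also have "\<dots> = (1 - t) powr (- 1 / 2)"
    using True by (simp flip: powr_realpow add: powr_powr)
  finally show ?thesis
    using True by (simp add: weight_def)
next
  case False
  then have "level t = 0"
    using level_eq_0[of t] by (auto simp: level_def)
  then show ?thesis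
    using weight_nonneg by simp
qed

text \<open>A common class for the velocity, its derivatives up to order two and its Laplacian. The
  factor \<open>real k ^ 4\<close> also forces \<open>F 0\<close> to vanish. Radius 2 comes from
  centres in the unit ball and bubbles of radius at most 1.\<close>

definition tempered :: "(nat \<Rightarrow> real^3 \<Rightarrow> 'b::euclidean_space) \<Rightarrow> bool" where
  "tempered F \<longleftrightarrow> (\<forall>k. continuous_on UNIV (F k)) \<and>
     (\<exists>C\<ge>0. \<forall>k x. norm (F k x) \<le> C * real k ^ 4 * indicator (cball 0 2) x)"

text \<open>Joint measurability holds because \<open>level\<close> has countably many measurable
  level sets and each \<open>F k\<close> is continuous.\<close>

lemma tempered_borel:
  assumes "tempered F"
  shows "(\<lambda>(t, x). F (level t) x) \<in> borel_measurable borel"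
proof -
  have [measurable]: "F k \<in> borel_measurable borel" for k
    using assms by (auto simp: tempered_def borel_measurable_continuous_onI)
  have "(\<lambda>p. F (level (fst p)) (snd p)) \<in> borel_measurable (borel \<Otimes>\<^sub>M borel)"
    by (rule measurable_compose_countable[where f = "\<lambda>k p. F k (snd p)" and g = "\<lambda>p. level (fst p)"])
      measurable
  then show ?thesis
    by (simp add: borel_prod case_prod_beta')
qed

text \<open>The norm is dominated by the product of \<open>C * weight t\<close> and the indicator of
  a ball in \<open>x\<close>, which is integrable by Tonelli.\<close>

lemma tempered_integrable:
  fixes F :: "nat \<Rightarrow> real^3 \<Rightarrow> 'b::euclidean_space"
  assumes "tempered F"
  shows "integrable lborel (\<lambda>(t, x). F (level t) x)"
proof -
  obtain C where C: "C \<ge> 0" "\<And>k x. norm (F k x) \<le> C * real k ^ 4 * indicator (cball 0 2) x"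
    using assms by (auto simp: tempered_def)
  let ?b = "\<lambda>p::real \<times> (real^3). C * weight (fst p) * indicator (cball 0 2) (snd p)"
  have "integrable (lborel \<Otimes>\<^sub>M lborel) ?b"
  proof (rule integrableI_bounded)
    have [measurable]: "(\<lambda>p. ennreal (C * weight (fst p)) * indicator (cball 0 2) (snd p))
        \<in> borel_measurable (lborel \<Otimes>\<^sub>M (lborel :: (real^3) measure))"
      by (intro borel_measurable_times_ennreal measurable_compose[OF measurable_snd] borel_measurable_indicator)
         measurable
    have "(\<integral>\<^sup>+ p. ennreal (norm (?b p)) \<partial>(lborel \<Otimes>\<^sub>M lborel))
        = (\<integral>\<^sup>+ p. ennreal (C * weight (fst p)) * indicator (cball 0 2) (snd p) \<partial>(lborel \<Otimes>\<^sub>M (lborel :: (real^3) measure)))"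
      by (auto simp: C weight_nonneg abs_mult ennreal_mult' ennreal_indicator intro!: nn_integral_cong)
    also have "\<dots> = (\<integral>\<^sup>+ t. \<integral>\<^sup>+ x. ennreal (C * weight t) * indicator (cball 0 2) (x::real^3) \<partial>lborel \<partial>lborel)"
      by (subst lborel.nn_integral_fst[symmetric]) auto
    also have "\<dots> = (\<integral>\<^sup>+ t. ennreal (C * weight t) * emeasure lborel (cball (0::real^3) 2) \<partial>lborel)"
      by (simp add: nn_integral_cmult_indicator)
    also have "\<dots> = (\<integral>\<^sup>+ t. ennreal (C * weight t) \<partial>lborel) * emeasure lborel (cball (0::real^3) 2)"
      by (simp add: nn_integral_multc)
    also have "\<dots> < \<infinity>"
    proof -
      have "(\<integral>\<^sup>+ t. ennreal (weight t) \<partial>lborel) < \<infinity>"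
        using integrable_weight by (simp add: integrable_iff_bounded weight_nonneg)
      then have "(\<integral>\<^sup>+ t. ennreal (C * weight t) \<partial>lborel) < \<infinity>"
        by (simp add: ennreal_mult' C nn_integral_cmult ennreal_mult_less_top)
      then show ?thesis
        using emeasure_lborel_cball_finite[of "0::real^3" 2] by (auto simp: ennreal_mult_less_top)
    qed
    finally show "(\<integral>\<^sup>+ p. ennreal (norm (?b p)) \<partial>(lborel \<Otimes>\<^sub>M lborel)) < \<infinity>" .
    show "?b \<in> borel_measurable (lborel \<Otimes>\<^sub>M lborel)"
      by (intro borel_measurable_times measurable_compose[OF measurable_snd] borel_measurable_indicator)
        measurable
  qed
  then have "integrable lborel ?b"
    by (simp add: lborel_prod)
  then show ?thesis
  proof (rule Bochner_Integration.integrable_bound)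
    show "(\<lambda>(t, x). F (level t) x) \<in> borel_measurable lborel"
      using tempered_borel[OF assms] by simp
    have "norm (F (level t) x) \<le> C * weight t * indicator (cball 0 2) x" for t x
    proof -
      have "C * real (level t) ^ 4 * indicator (cball 0 2) x \<le> C * weight t * indicator (cball 0 2) x"
        using C(1) level_power_le_weight by (intro mult_right_mono mult_left_mono) auto
      then show ?thesis using C(2)[of "level t" x] by linarith
    qed
    then show "AE p in lborel. norm (case p of (t, x) \<Rightarrow> F (level t) x) \<le> norm (?b p)"
      by (auto simp: C weight_nonneg abs_mult split: prod.splits)
  qed
qed

lemma locally_integrable_lborel:
  fixes f :: "'a::euclidean_space \<Rightarrow> 'b::euclidean_space"
  assumes "integrable lborel f"
  shows "locally_integrable S f"
proof -
  have "f absolutely_integrable_on UNIV"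
    using assms borel_measurable_integrable[OF assms]
    by (simp add: set_integrable_def integrable_completion)
  then show ?thesis
    unfolding locally_integrable_def
    using compact_imp_closed set_integrable_subset[where A = UNIV]
    by (metis borel_closed sets_completionI_sets sets_lborel subset_UNIV)
qed

section \<open>The solution and the Stokes equation\<close>

text \<open>The amplitude \<open>k\<close> together with the radius \<open>1 / (k + 1)\<close> keeps the \<open>L\<^sup>2\<close> norm bounded,
  while the sup norm tends to infinity. The velocity is \<open>bubble c (level t)\<close>, whose level tends to
  infinity as \<open>t\<close> increases to 1, so slowly that \<open>(level t) ^ 4\<close> is integrable.\<close>

definition bubble :: "(nat \<Rightarrow> real^3) \<Rightarrow> nat \<Rightarrow> real^3 \<Rightarrow> real^3" where
  "bubble c k x = real k *\<^sub>R swirl (real (Suc k) *\<^sub>R (x - c k))"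

lemma tempered_scaled:
  fixes u :: "real^3 \<Rightarrow> 'b::euclidean_space"
  assumes "smooth u" "\<And>x. x \<notin> cball 0 1 \<Longrightarrow> u x = 0"
    and c: "\<And>k. norm (c k) \<le> 1" and a: "\<And>k. \<bar>a k\<bar> \<le> C * real k ^ 4"
  shows "tempered (\<lambda>k x. a k *\<^sub>R u (real (Suc k) *\<^sub>R (x - c k)))"
proof -
  obtain B where B: "B \<ge> 0" "\<And>x. norm (u x) \<le> B"
    using bounded_bounded_support[OF smooth_continuous_on[OF assms(1)] assms(2)] by blast
  \<comment> \<open>At \<open>k = 1\<close> the hypothesis reads
    \<open>\<bar>a 1\<bar> \<le> C\<close>.\<close>
  have C: "C \<ge> 0" using a[of 1] by simp
  have "norm (a k *\<^sub>R u (real (Suc k) *\<^sub>R (x - c k))) \<le> C * B * real k ^ 4 * indicator (cball 0 2) x" for k x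
  proof (cases "x \<in> cball 0 2")
    case True
    have "norm (a k *\<^sub>R u (real (Suc k) *\<^sub>R (x - c k))) \<le> (C * real k ^ 4) * B"
      using B a[of k] C by (auto intro!: mult_mono)
    with True show ?thesis by (simp add: mult_ac)
  next
    case False
    then have "1 < norm (x - c k)"
      using c[of k] norm_triangle_sub[of x "c k"] by simp
    also have "\<dots> \<le> norm (real (Suc k) *\<^sub>R (x - c k))"
      by (simp add: mult_le_cancel_right1)
    finally have "u (real (Suc k) *\<^sub>R (x - c k)) = 0"
      by (intro assms(2)) simp
    with False show ?thesis by simp
  qed
  moreover have "continuous_on UNIV (\<lambda>x. a k *\<^sub>R u (real (Suc k) *\<^sub>R (x - c k)))" for k
    by (rule smooth_continuous_on[OF smooth_affine(1)[OF assms(1)]])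
  ultimately show ?thesis
    unfolding tempered_def using B(1) C mult_nonneg_nonneg by blast
qed

lemma tempered_eq_0: "tempered F \<Longrightarrow> x \<notin> cball 0 2 \<Longrightarrow> F k x = 0"
  by (auto simp: tempered_def dest!: spec[of _ k] spec[of _ x])

section \<open>Derivatives, divergence and growth of the bubbles\<close>

lemma smooth_bubble: "smooth (bubble c k)"
  unfolding bubble_def[abs_def] by (rule smooth_affine(1)[OF smooth_swirl])

lemma dirderiv_bubble:
  "dirderiv v (bubble c k) =
    (\<lambda>x. (real k * real (Suc k)) *\<^sub>R dirderiv v swirl (real (Suc k) *\<^sub>R (x - c k)))"
  unfolding bubble_def[abs_def] by (rule smooth_affine(2)[OF smooth_swirl])

lemma dirderiv2_bubble:
  "dirderiv w (dirderiv v (bubble c k)) =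
    (\<lambda>x. (real k * real (Suc k) * real (Suc k)) *\<^sub>R
       dirderiv w (dirderiv v swirl) (real (Suc k) *\<^sub>R (x - c k)))"
  unfolding dirderiv_bubble by (rule smooth_affine(2)[OF smooth_dirderiv[OF smooth_swirl]])

lemma div_bubble: "(\<Sum>i\<in>UNIV. dirderiv (axis i 1) (bubble c k) x $ i) = 0"
  by (simp add: dirderiv_bubble div_swirl flip: sum_distrib_left)

lemma dirderiv_swirl_eq_0: "x \<notin> cball 0 1 \<Longrightarrow> dirderiv v swirl x = 0"
  by (rule dirderiv_zero_off[OF closed_cball swirl_eq_0])

lemma dirderiv2_swirl_eq_0: "x \<notin> cball 0 1 \<Longrightarrow> dirderiv w (dirderiv v swirl) x = 0"
  by (rule dirderiv_zero_off[OF closed_cball dirderiv_swirl_eq_0])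

text \<open>These are the factors in front of a bubble and its first and second derivatives. The
  last one dominates the others; the constant 4 comes from using \<open>k + 1 \<le> 2 * k\<close>
  twice.\<close>

lemma nat_power_bounds:
  "real k \<le> 4 * real k ^ 4" "real k * real (Suc k) \<le> 4 * real k ^ 4"
  "real k * real (Suc k) * real (Suc k) \<le> 4 * real k ^ 4"
proof -
  have "k * Suc k * Suc k \<le> 4 * k ^ 4"
  proof (cases k)
    case (Suc m)
    then have "k * Suc k * Suc k \<le> k * (2 * k) * (2 * k)"
      by (intro mult_mono) auto
    also have "\<dots> = 4 * k ^ 3"
      by (simp add: power3_eq_cube)
    also have "\<dots> \<le> 4 * k ^ 4"
      using Suc by (intro mult_left_mono power_increasing) auto
    finally show ?thesis .
  qed simp
  then have "real (k * Suc k * Suc k) \<le> real (4 * k ^ 4)"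
    by (rule of_nat_mono)
  then show 3: "real k * real (Suc k) * real (Suc k) \<le> 4 * real k ^ 4"
    by (simp only: of_nat_mult of_nat_power of_nat_numeral)
  have "real k * 1 \<le> real k * real (Suc k)"
    by (intro mult_left_mono) auto
  moreover have "real k * real (Suc k) * 1 \<le> real k * real (Suc k) * real (Suc k)"
    by (intro mult_left_mono) auto
  ultimately show "real k \<le> 4 * real k ^ 4" "real k * real (Suc k) \<le> 4 * real k ^ 4"
    using 3 by linarith+
qed

lemma tempered_bubble:
  assumes "\<And>k. norm (c k) \<le> 1"
  shows "tempered (bubble c)"
    and "tempered (\<lambda>k. dirderiv v (bubble c k))"
    and "tempered (\<lambda>k. dirderiv w (dirderiv v (bubble c k)))"
proof -
  show "tempered (bubble c)"
    unfolding bubble_def[abs_def]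
    by (intro tempered_scaled[where C = 4] smooth_swirl swirl_eq_0 assms)
      (use nat_power_bounds in simp_all)
  show "tempered (\<lambda>k. dirderiv v (bubble c k))"
    unfolding dirderiv_bubble
    by (intro tempered_scaled[where C = 4] smooth_dirderiv smooth_swirl dirderiv_swirl_eq_0 assms)
      (use nat_power_bounds in \<open>simp_all del: of_nat_Suc add: abs_mult\<close>)
  show "tempered (\<lambda>k. dirderiv w (dirderiv v (bubble c k)))"
    unfolding dirderiv2_bubble
    by (intro tempered_scaled[where C = 4] smooth_dirderiv smooth_swirl dirderiv2_swirl_eq_0 assms)
      (use nat_power_bounds in \<open>simp_all del: of_nat_Suc add: abs_mult\<close>)
qed

lemma tempered_component:
  fixes F :: "nat \<Rightarrow> real^3 \<Rightarrow> real^3"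
  assumes "tempered F"
  shows "tempered (\<lambda>k x. F k x $ i)"
proof -
  obtain C where "C \<ge> 0" "\<And>k x. norm (F k x) \<le> C * real k ^ 4 * indicator (cball 0 2) x"
    and cont: "\<And>k. continuous_on UNIV (F k)"
    using assms by (auto simp: tempered_def)
  then have "\<forall>k x. norm (F k x $ i) \<le> C * real k ^ 4 * indicator (cball 0 2) x"
    using component_le_norm_cart order_trans unfolding real_norm_def by blast
  then show ?thesis
    unfolding tempered_def
    using \<open>C \<ge> 0\<close> bounded_linear.continuous_on[OF bounded_linear_vec_nth cont] by blast
qed

text \<open>A form of compact support that passes to derivatives with the same radius, so
  derivatives of test functions can be used again as test functions.\<close>

definition bounded_support :: "('a::real_normed_vector \<Rightarrow> 'b::zero) \<Rightarrow> bool" where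
  "bounded_support \<phi> \<longleftrightarrow> (\<exists>R. \<forall>x. x \<notin> cball 0 R \<longrightarrow> \<phi> x = 0)"

lemma bounded_support_test_function:
  assumes "\<phi> \<in> test_functions \<Omega>"
  shows "smooth \<phi>" "bounded_support \<phi>"
proof -
  show "smooth \<phi>" using assms by (simp add: test_functions_def)
  have "compact (supp \<phi>)"
    using assms by (simp add: test_functions_def)
  then have "bounded {x. \<phi> x \<noteq> 0}"
    unfolding supp_def using compact_imp_bounded bounded_subset closure_subset by metis
  then obtain R where "\<And>x. \<phi> x \<noteq> 0 \<Longrightarrow> norm x \<le> R"
    by (auto simp: bounded_iff)
  then show "bounded_support \<phi>"
    unfolding bounded_support_def by (metis mem_cball_0)
qed

lemma bounded_support_dirderiv: "bounded_support \<phi> \<Longrightarrow> bounded_support (dirderiv v \<phi>)"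
  unfolding bounded_support_def using dirderiv_zero_off[OF closed_cball] by blast

text \<open>The test function is bounded, so the product is dominated by a multiple of
  \<open>norm (F (level t) x)\<close>. Fubini applies to the Borel representative, whose integral is
  unchanged by completion.\<close>

lemma tempered_test_integral:
  fixes F :: "nat \<Rightarrow> real^3 \<Rightarrow> 'b::euclidean_space" and \<phi> :: "real \<times> (real^3) \<Rightarrow> 'b"
  assumes "tempered F" "smooth \<phi>" "bounded_support \<phi>"
  shows "integrable lebesgue (\<lambda>(t, x). F (level t) x \<bullet> \<phi> (t, x))"
    and "(\<integral>(t, x). F (level t) x \<bullet> \<phi> (t, x) \<partial>lebesgue)
      = (\<integral>t. \<integral>x. F (level t) x \<bullet> \<phi> (t, x) \<partial>lborel \<partial>lborel)"
proof -
  obtain R where "\<And>p. p \<notin> cball 0 R \<Longrightarrow> \<phi> p = 0"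
    using assms(3) by (auto simp: bounded_support_def)
  from bounded_bounded_support[OF smooth_continuous_on[OF assms(2)] this]
  obtain B where B: "B \<ge> 0" "\<And>p. norm (\<phi> p) \<le> B" by blast
  have [measurable]: "\<phi> \<in> borel_measurable borel"
    using smooth_continuous_on[OF assms(2)] by (rule borel_measurable_continuous_onI)
  have [measurable]: "(\<lambda>p. F (level (fst p)) (snd p)) \<in> borel_measurable borel"
    using tempered_borel[OF assms(1)] by (simp add: case_prod_beta')
  have m: "(\<lambda>p. F (level (fst p)) (snd p) \<bullet> \<phi> p) \<in> borel_measurable borel"
    by measurable
  have i: "integrable lborel (\<lambda>p. F (level (fst p)) (snd p) \<bullet> \<phi> p)"
  proof (rule Bochner_Integration.integrable_bound)
    show "integrable lborel (\<lambda>p. B * norm (F (level (fst p)) (snd p)))"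
      using tempered_integrable[OF assms(1)] by (simp add: case_prod_beta')
    have "norm (F (level (fst p)) (snd p) \<bullet> \<phi> p) \<le> norm (F (level (fst p)) (snd p)) * B" for p
      unfolding real_norm_def
      by (rule order_trans[OF Cauchy_Schwarz_ineq2 mult_left_mono[OF B(2) norm_ge_zero]])
    then show "AE p in lborel. norm (F (level (fst p)) (snd p) \<bullet> \<phi> p)
        \<le> norm (B * norm (F (level (fst p)) (snd p)))"
      using B(1) by (simp add: abs_mult mult.commute)
  qed (use m in simp)
  show "integrable lebesgue (\<lambda>(t, x). F (level t) x \<bullet> \<phi> (t, x))"
    using i m by (simp add: integrable_completion case_prod_beta')
  have "(\<integral>t. \<integral>x. F (level t) x \<bullet> \<phi> (t, x) \<partial>lborel \<partial>lborel)
      = (\<integral>p. F (level (fst p)) (snd p) \<bullet> \<phi> p \<partial>(lborel \<Otimes>\<^sub>M lborel))"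
    using i by (subst lborel_pair.integral_fst'[symmetric]) (simp_all add: lborel_prod)
  then show "(\<integral>(t, x). F (level t) x \<bullet> \<phi> (t, x) \<partial>lebesgue)
      = (\<integral>t. \<integral>x. F (level t) x \<bullet> \<phi> (t, x) \<partial>lborel \<partial>lborel)"
    using m by (simp add: lborel_prod integral_completion case_prod_beta')
qed

text \<open>After Fubini the identity holds for each \<open>t\<close> separately, where
  \<open>F (level t)\<close> is a smooth function of \<open>x\<close> with bounded support.\<close>

lemma tempered_integration_by_parts:
  fixes F :: "nat \<Rightarrow> real^3 \<Rightarrow> 'b::euclidean_space" and \<phi> :: "real \<times> (real^3) \<Rightarrow> 'b"
  assumes F: "\<And>k. smooth (F k)" "tempered F" "tempered (\<lambda>k. dirderiv v (F k))"
    and \<phi>: "smooth \<phi>" "bounded_support \<phi>"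
  shows "(\<integral>(t, x). F (level t) x \<bullet> dirderiv (0, v) \<phi> (t, x) \<partial>lebesgue)
     = - (\<integral>(t, x). dirderiv v (F (level t)) x \<bullet> \<phi> (t, x) \<partial>lebesgue)"
proof -
  have "(\<integral>x. F (level t) x \<bullet> dirderiv (0, v) \<phi> (t, x) \<partial>lborel)
      = - (\<integral>x. dirderiv v (F (level t)) x \<bullet> \<phi> (t, x) \<partial>lborel)" for t
    using integral_inner_dirderiv[where u = "F (level t)" and w = "\<lambda>x. \<phi> (t, x)" and v = v and R = 2,
        OF F(1) smooth_slice(1)[OF \<phi>(1)] tempered_eq_0[OF F(2)]]
    by (simp add: smooth_slice(2)[OF \<phi>(1)])
  then show ?thesis
    using tempered_test_integral(2)[OF F(2) smooth_dirderiv[OF \<phi>(1)] bounded_support_dirderiv[OF \<phi>(2)]]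
      tempered_test_integral(2)[OF F(3) \<phi>]
    by simp
qed

text \<open>The Laplacian of a single time slice. The operator \<open>laplace\<close> relies on
  Frechet derivatives in space-time, which a field with jumps in time need not have.\<close>

definition lap :: "('a::euclidean_space \<Rightarrow> 'b::real_normed_vector) \<Rightarrow> 'a \<Rightarrow> 'b" where
  "lap u x = (\<Sum>b\<in>Basis. dirderiv b (dirderiv b u) x)"

lemma Basis_vec3: "(\<Sum>b\<in>Basis. h b) = (\<Sum>i\<in>UNIV. h (axis i 1))" for h :: "real^3 \<Rightarrow> 'b::comm_monoid_add"
proof -
  have "(Basis :: (real^3) set) = range (\<lambda>i. axis i 1)"
    by (auto simp: Basis_vec_def)
  then show ?thesis
    using sum.reindex[of "\<lambda>i::3. axis i (1::real)" UNIV h] by (simp add: inj_on_def axis_eq_axis)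
qed

lemma tempered_lap_bubble:
  assumes "\<And>k. norm (c k) \<le> 1"
  shows "tempered (\<lambda>k. lap (bubble c k))"
proof -
  have "tempered F \<Longrightarrow> tempered G \<Longrightarrow> tempered (\<lambda>k x. F k x + G k x)"
    for F G :: "nat \<Rightarrow> real^3 \<Rightarrow> real^3"
  proof -
    assume F: "tempered F" and G: "tempered G"
    obtain C where C: "C \<ge> 0" "\<And>k x. norm (F k x) \<le> C * real k ^ 4 * indicator (cball 0 2) x"
      using F by (auto simp: tempered_def)
    obtain D where D: "D \<ge> 0" "\<And>k x. norm (G k x) \<le> D * real k ^ 4 * indicator (cball 0 2) x"
      using G by (auto simp: tempered_def)
    have "norm (F k x + G k x) \<le> (C + D) * real k ^ 4 * indicator (cball 0 2) x" for k x
      using norm_triangle_ineq[of "F k x" "G k x"] C(2)[of k x] D(2)[of k x]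
      by (simp add: algebra_simps)
    then show ?thesis
      using F G C(1) D(1) add_nonneg_nonneg
      unfolding tempered_def by (blast intro: continuous_on_add)
  qed
  note add = this
  have "tempered (\<lambda>k. dirderiv v (dirderiv w (bubble c k)))" for v w
    by (rule tempered_bubble(3)) (rule assms)
  from add[OF this add[OF this this], of "axis 1 1" "axis 1 1" "axis 2 1" "axis 2 1" "axis 3 1" "axis 3 1"]
  show ?thesis
    by (simp add: lap_def[abs_def] Basis_vec3 sum_3 add.assoc)
qed

lemma stokes_bubble:
  assumes c: "\<And>k. norm (c k) \<le> 1"
  defines "z \<equiv> \<lambda>t. bubble c (level t)"
  shows "stokes_solution (\<lambda>x. 0) (\<lambda>t x. - lap (z t) x) z z"
proof -
  note T = tempered_bubble[where c = c, OF c]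
  show ?thesis
    unfolding stokes_solution_def
  proof (intro conjI ballI allI impI exI[of _ "\<lambda>\<phi>. 0"])
    \<comment> \<open>The field vanishes on a right neighbourhood of 0, so the tested integrals in
      the initial condition are eventually constant.\<close>
    have z0: "z t = (\<lambda>x. 0)" if "t \<le> 1 / 2" for t
      using level_eq_0[OF that] by (simp add: z_def bubble_def fun_eq_iff)
    show "locally_integrable spacetime0 (\<lambda>(t, x). z t x)"
      unfolding z_def by (rule locally_integrable_lborel[OF tempered_integrable[OF T(1)]])
    show "locally_integrable UNIV (z t)" for t
      unfolding z_def using T(1)
      by (intro locally_integrable_lborel integrable_bounded_support smooth_continuous_on smooth_bubble)
        (rule tempered_eq_0)
    show "distribution_on spacetime (\<lambda>\<phi>. 0)"
      by (auto simp: distribution_on_def intro!: exI[of _ 0])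
    show "z 0 = (\<lambda>x. 0)"
      by (rule z0) simp
    fix \<psi> :: "real^3 \<Rightarrow> real^3"
    show "((\<lambda>t. \<integral>x. z t x \<bullet> \<psi> x \<partial>lebesgue) \<longlongrightarrow> (\<integral>x. 0 \<bullet> \<psi> x \<partial>lebesgue)) (at_right 0)"
      by (rule tendsto_eventually)
        (auto simp: eventually_at_right_field z0 intro!: exI[of _ "1/2"])
  next
    fix \<phi> :: "real \<times> (real^3) \<Rightarrow> real^3"
    assume "\<phi> \<in> test_functions spacetime"
    note \<phi> = bounded_support_test_function[OF this]
    note d\<phi> = smooth_dirderiv[OF \<phi>(1)] bounded_support_dirderiv[OF \<phi>(2)]
    note dd\<phi> = smooth_dirderiv[OF d\<phi>(1)] bounded_support_dirderiv[OF d\<phi>(2)]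
    \<comment> \<open>Two integrations by parts in each direction move the Laplacian from
      \<open>\<phi>\<close> onto \<open>z\<close>, and their signs cancel. The terms with
      \<open>dt \<phi>\<close> on the two sides of the equation are the same integral.\<close>
    have "(\<integral>(t, x). z t x \<bullet> laplace \<phi> (t, x) \<partial>lebesgue)
        = (\<integral>p. (\<Sum>i\<in>UNIV. (case p of (t, x) \<Rightarrow> z t x \<bullet> dx i (dx i \<phi>) (t, x))) \<partial>lebesgue)"
      by (simp add: laplace_def inner_sum_right case_prod_beta')
    also have "\<dots> = (\<Sum>i\<in>UNIV. \<integral>(t, x). z t x \<bullet> dx i (dx i \<phi>) (t, x) \<partial>lebesgue)"
      unfolding z_def dx_def
      by (intro Bochner_Integration.integral_sum tempered_test_integral(1) T dd\<phi>)
    also have "\<dots> = (\<Sum>i\<in>UNIV. \<integral>(t, x). dirderiv (axis i 1) (dirderiv (axis i 1) (z t)) x \<bullet> \<phi> (t, x) \<partial>lebesgue)"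
    proof (rule sum.cong)
      fix i :: 3
      show "(\<integral>(t, x). z t x \<bullet> dx i (dx i \<phi>) (t, x) \<partial>lebesgue)
         = (\<integral>(t, x). dirderiv (axis i 1) (dirderiv (axis i 1) (z t)) x \<bullet> \<phi> (t, x) \<partial>lebesgue)"
        unfolding z_def dx_def
        by (simp add: tempered_integration_by_parts[OF smooth_bubble T(1,2) d\<phi>]
            tempered_integration_by_parts[OF smooth_dirderiv[OF smooth_bubble] T(2,3) \<phi>])
    qed simp
    also have "\<dots> = (\<integral>p. (\<Sum>i\<in>UNIV. (case p of (t, x) \<Rightarrow>
        dirderiv (axis i 1) (dirderiv (axis i 1) (z t)) x \<bullet> \<phi> (t, x))) \<partial>lebesgue)"
      unfolding z_def
      by (intro Bochner_Integration.integral_sum[symmetric] tempered_test_integral(1) T \<phi>)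
    also have "\<dots> = (\<integral>(t, x). lap (z t) x \<bullet> \<phi> (t, x) \<partial>lebesgue)"
      by (simp add: lap_def Basis_vec3 inner_sum_left case_prod_beta')
    finally show "- (\<integral>(t, x). z t x \<bullet> dt \<phi> (t, x) \<partial>lebesgue)
        - (\<integral>(t, x). z t x \<bullet> laplace \<phi> (t, x) \<partial>lebesgue) - 0
        = (\<integral>(t, x). - lap (z t) x \<bullet> \<phi> (t, x) \<partial>lebesgue)
        - (\<integral>(t, x). z t x \<bullet> dt \<phi> (t, x) \<partial>lebesgue)"
      by (simp add: case_prod_beta')
  next
    fix \<psi> :: "real \<times> (real^3) \<Rightarrow> real"
    assume "\<psi> \<in> test_functions spacetime"
    note \<psi> = bounded_support_test_function[OF this]
    note d\<psi> = smooth_dirderiv[OF \<psi>(1)] bounded_support_dirderiv[OF \<psi>(2)]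
    note comp = smooth_component[OF smooth_bubble[of c]]
    have dcomp: "tempered (\<lambda>k. dirderiv v (\<lambda>x. bubble c k x $ i))" for v i
      unfolding comp(2) by (rule tempered_component[OF T(2)])
    \<comment> \<open>Components are paired by the inner product of \<open>real\<close>, so that the
      integration by parts applies to scalar fields; the sum then contains the divergence of a
      bubble.\<close>
    have "(\<integral>(t, x). z t x \<bullet> grad \<psi> (t, x) \<partial>lebesgue)
        = (\<integral>p. (\<Sum>i\<in>UNIV. (case p of (t, x) \<Rightarrow> z t x $ i \<bullet> dx i \<psi> (t, x))) \<partial>lebesgue)"
      by (simp add: grad_def inner_vec_def case_prod_beta')
    also have "\<dots> = (\<Sum>i\<in>UNIV. \<integral>(t, x). z t x $ i \<bullet> dx i \<psi> (t, x) \<partial>lebesgue)"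
      unfolding z_def dx_def
      by (intro Bochner_Integration.integral_sum tempered_test_integral(1) tempered_component T d\<psi>)
    also have "\<dots> = (\<Sum>i\<in>UNIV. - (\<integral>(t, x). dirderiv (axis i 1) (z t) x $ i \<bullet> \<psi> (t, x) \<partial>lebesgue))"
      unfolding z_def dx_def
      using tempered_integration_by_parts[OF comp(1) tempered_component[OF T(1)] dcomp \<psi>]
      by (simp add: comp(2))
    also have "\<dots> = - (\<integral>p. (\<Sum>i\<in>UNIV. (case p of (t, x) \<Rightarrow>
        dirderiv (axis i 1) (z t) x $ i \<bullet> \<psi> (t, x))) \<partial>lebesgue)"
      unfolding z_def sum_negf
      by (intro arg_cong[where f = uminus] Bochner_Integration.integral_sum[symmetric]
          tempered_test_integral(1) tempered_component T \<psi>)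
    also have "\<dots> = 0"
      by (simp add: z_def div_bubble case_prod_beta' flip: sum_distrib_right)
    finally show "(\<integral>(t, x). z t x \<bullet> grad \<psi> (t, x) \<partial>lebesgue) = 0" .
  qed
qed

section \<open>Bochner norms of the solution\<close>

text \<open>The integrand is at most the square of \<open>a\<close> times a sup bound of
  \<open>u\<close>, on a ball of radius \<open>1 / real (Suc k)\<close>; the cube is the volume
  scaling in dimension three.\<close>

lemma L2_sqnorm_scaled:
  fixes u :: "real^3 \<Rightarrow> 'b::euclidean_space"
  assumes u: "continuous_on UNIV u" "\<And>x. x \<notin> cball 0 1 \<Longrightarrow> u x = 0"
  obtains V where "V \<ge> 0"
    "\<And>a c k. L2_sqnorm (\<lambda>x. a *\<^sub>R u (real (Suc k) *\<^sub>R (x - c))) \<le> ennreal (V * (a\<^sup>2 / real (Suc k) ^ 3))"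
proof -
  obtain B where B: "B \<ge> 0" "\<And>x. norm (u x) \<le> B"
    using bounded_bounded_support[OF u] by blast
  define V where "V = B\<^sup>2 * unit_ball_vol 3"
  have "L2_sqnorm (\<lambda>x. a *\<^sub>R u (real (Suc k) *\<^sub>R (x - c))) \<le> ennreal (V * (a\<^sup>2 / real (Suc k) ^ 3))" for a c k
  proof -
    let ?w = "\<lambda>x. a *\<^sub>R u (real (Suc k) *\<^sub>R (x - c))" and ?S = "cball c (1 / real (Suc k))"
    have "continuous_on UNIV ?w"
      by (intro continuous_intros continuous_on_compose2[OF u(1)]) auto
    then have meas: "?w \<in> borel_measurable borel"
      by (rule borel_measurable_continuous_onI)
    have "(norm (?w x))\<^sup>2 \<le> (a\<^sup>2 * B\<^sup>2) * indicator ?S x" for x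
    proof (cases "x \<in> ?S")
      case True
      have "norm (?w x) \<le> \<bar>a\<bar> * B"
        using B by (simp add: mult_left_mono)
      then have "(norm (?w x))\<^sup>2 \<le> (\<bar>a\<bar> * B)\<^sup>2"
        by (rule power_mono) simp
      with True show ?thesis by (simp add: power_mult_distrib)
    next
      case False
      then have "1 < real (Suc k) * norm (x - c)"
        by (simp add: dist_norm norm_minus_commute field_simps del: of_nat_Suc)
      then have "u (real (Suc k) *\<^sub>R (x - c)) = 0"
        by (intro u(2)) (simp del: of_nat_Suc)
      with False show ?thesis by simp
    qed
    then have "ennreal ((norm (?w x))\<^sup>2) \<le> ennreal ((a\<^sup>2 * B\<^sup>2) * indicator ?S x)" for x
      by (rule ennreal_leI)
    then have "ennreal ((norm (?w x))\<^sup>2) \<le> ennreal (a\<^sup>2 * B\<^sup>2) * indicator ?S x" for x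
      by (simp only: ennreal_mult''[OF indicator_pos_le] ennreal_indicator)
    then have "(\<integral>\<^sup>+x. ennreal ((norm (?w x))\<^sup>2) \<partial>lborel) \<le> (\<integral>\<^sup>+x. ennreal (a\<^sup>2 * B\<^sup>2) * indicator ?S x \<partial>lborel)"
      by (rule nn_integral_mono)
    also have "\<dots> = ennreal (a\<^sup>2 * B\<^sup>2) * emeasure lborel ?S"
      by (rule nn_integral_cmult_indicator) simp
    also have "\<dots> = ennreal (V * (a\<^sup>2 / real (Suc k) ^ 3))"
      by (simp add: emeasure_cball V_def power_divide mult_ac del: of_nat_Suc flip: ennreal_mult')
    finally have "(\<integral>\<^sup>+x. ennreal ((norm (?w x))\<^sup>2) \<partial>lborel) \<le> ennreal (V * (a\<^sup>2 / real (Suc k) ^ 3))" .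
    moreover have "?w \<in> borel_measurable lebesgue"
      by (intro measurable_completion) (use meas in simp)
    ultimately show ?thesis
      by (simp only: L2_sqnorm_def nn_integral_completion if_True)
  qed
  then show ?thesis
    using that[of V] by (simp add: V_def)
qed

text \<open>The ratio k^2 / (k + 1)^3 is at most 1 and zero at k = 0, hence also at most k^4. The
  uniform bound serves the supremum in time; the one vanishing at level zero enters the time
  integral of the H^1 norm.\<close>

lemma L2_sqnorm_bubble:
  obtains C where "C \<ge> 0" "\<And>k. L2_sqnorm (bubble c k) \<le> ennreal C"
    "\<And>k. L2_sqnorm (bubble c k) \<le> ennreal (C * real k ^ 4)"
proof -
  obtain V where V: "V \<ge> 0"
    "\<And>a c k. L2_sqnorm (\<lambda>x. a *\<^sub>R swirl (real (Suc k) *\<^sub>R (x - c))) \<le> ennreal (V * (a\<^sup>2 / real (Suc k) ^ 3))"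
    using L2_sqnorm_scaled[OF smooth_continuous_on[OF smooth_swirl] swirl_eq_0] by blast
  have 1: "(real k)\<^sup>2 / real (Suc k) ^ 3 \<le> 1" for k
  proof -
    have "(real k)\<^sup>2 \<le> real (Suc k) ^ 2"
      by (intro power_mono) auto
    also have "\<dots> \<le> real (Suc k) ^ 3"
      by (intro power_increasing) auto
    finally show ?thesis by (simp del: of_nat_Suc)
  qed
  have 2: "(real k)\<^sup>2 / real (Suc k) ^ 3 \<le> real k ^ 4" for k
    using 1[of k] one_le_power[of "real k" 4] by (cases "k = 0") (simp, linarith)
  show ?thesis
  proof (rule that[OF V(1)])
    fix k
    have "L2_sqnorm (bubble c k) \<le> ennreal (V * ((real k)\<^sup>2 / real (Suc k) ^ 3))"
      unfolding bubble_def[abs_def] by (rule V(2))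
    moreover have "V * ((real k)\<^sup>2 / real (Suc k) ^ 3) \<le> V"
      using mult_left_mono[OF 1 V(1)] by simp
    moreover have "V * ((real k)\<^sup>2 / real (Suc k) ^ 3) \<le> V * real k ^ 4"
      by (rule mult_left_mono[OF 2 V(1)])
    ultimately show "L2_sqnorm (bubble c k) \<le> ennreal V"
      "L2_sqnorm (bubble c k) \<le> ennreal (V * real k ^ 4)"
      by (blast intro: order_trans ennreal_leI)+
  qed
qed

section \<open>The weak gradient and the H^1 norm of the bubbles\<close>

definition jacobian :: "(real^3 \<Rightarrow> real^3) \<Rightarrow> real^3 \<Rightarrow> real^3^3" where
  "jacobian u x = (\<chi> i j. dirderiv (axis j 1) u x $ i)"

lemma continuous_on_jacobian: "smooth u \<Longrightarrow> continuous_on S (jacobian u)"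
  unfolding jacobian_def
  by (intro continuous_on_vec_lambda bounded_linear.continuous_on[OF bounded_linear_vec_nth]
      smooth_continuous_on smooth_dirderiv)

lemma jacobian_eq_0:
  assumes "closed S" "\<And>x. x \<notin> S \<Longrightarrow> u x = 0" "x \<notin> S"
  shows "jacobian u x = 0"
  using dirderiv_zero_off[where u = u, OF assms] by (simp add: jacobian_def vec_eq_iff)

lemma has_weak_gradient_jacobian:
  assumes "smooth u" and supp: "\<And>x. x \<notin> cball 0 R \<Longrightarrow> u x = 0"
  shows "has_weak_gradient u (jacobian u)"
  unfolding has_weak_gradient_def
proof (intro conjI ballI allI)
  show "locally_integrable UNIV u"
    by (intro locally_integrable_lborel integrable_bounded_support[where R = R] smooth_continuous_on assms)
  show "locally_integrable UNIV (jacobian u)"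
    by (intro locally_integrable_lborel integrable_bounded_support[where R = R]
        continuous_on_jacobian assms(1) jacobian_eq_0[OF closed_cball supp])
  fix \<psi> :: "real^3 \<Rightarrow> real" and i j :: 3
  assume "\<psi> \<in> test_functions UNIV"
  then have \<psi>: "smooth \<psi>"
    by (simp add: test_functions_def)
  note cont = smooth_continuous_on[OF \<psi>] smooth_continuous_on[OF smooth_dirderiv[OF \<psi>]]
    smooth_continuous_on[OF smooth_component(1)[OF assms(1)]]
    smooth_continuous_on[OF smooth_component(1)[OF smooth_dirderiv[OF assms(1)]]]
  have "(\<integral>x. u x $ i \<bullet> dirderiv (axis j 1) \<psi> x \<partial>lborel)
      = - (\<integral>x. dirderiv (axis j 1) (\<lambda>x. u x $ i) x \<bullet> \<psi> x \<partial>lborel)"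
    by (rule integral_inner_dirderiv[OF smooth_component(1)[OF assms(1)] \<psi>, where R = R])
      (simp add: supp)
  then show "(\<integral>x. u x $ i * dirderiv (axis j 1) \<psi> x \<partial>lebesgue)
      = - (\<integral>x. jacobian u x $ i $ j * \<psi> x \<partial>lebesgue)"
    by (simp add: smooth_component(2)[OF assms(1)] jacobian_def integral_completion
        borel_measurable_continuous_onI continuous_intros cont)
qed

text \<open>The chain rule raises the amplitude to k (k + 1) without enlarging the ball, so the
  gradient contributes a multiple of k^2 / (k + 1). The classical Jacobian is an admissible weak
  gradient in the infimum.\<close>

lemma H1_sqnorm_bubble:
  assumes "\<And>k. norm (c k) \<le> 1"
  obtains C where "C \<ge> 0" "\<And>k. H1_sqnorm (bubble c k) \<le> ennreal (C * real k ^ 4)"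
proof -
  obtain C where C: "C \<ge> 0" "\<And>k. L2_sqnorm (bubble c k) \<le> ennreal (C * real k ^ 4)"
    using L2_sqnorm_bubble by metis
  have z: "jacobian swirl x = 0" if "x \<notin> cball 0 1" for x
    by (rule jacobian_eq_0[OF closed_cball swirl_eq_0 that])
  obtain V where V: "V \<ge> 0" "\<And>a c k. L2_sqnorm (\<lambda>x. a *\<^sub>R jacobian swirl (real (Suc k) *\<^sub>R (x - c)))
       \<le> ennreal (V * (a\<^sup>2 / real (Suc k) ^ 3))"
    using L2_sqnorm_scaled[OF continuous_on_jacobian[OF smooth_swirl] z]
    by blast
  have J: "jacobian (bubble c k) = (\<lambda>x. (real k * real (Suc k)) *\<^sub>R jacobian swirl (real (Suc k) *\<^sub>R (x - c k)))" for k
    by (simp add: jacobian_def dirderiv_bubble vec_eq_iff fun_eq_iff del: of_nat_Suc)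
  have "(real k * real (Suc k))\<^sup>2 / real (Suc k) ^ 3 \<le> real k ^ 4" for k
  proof (cases k)
    case (Suc m)
    have "(real k * real (Suc k))\<^sup>2 / real (Suc k) ^ 3 = (real k)\<^sup>2 / real (Suc k)"
      by (simp add: power2_eq_square power3_eq_cube del: of_nat_Suc)
    also have "\<dots> \<le> (real k)\<^sup>2 / 1"
      by (intro divide_left_mono) auto
    also have "\<dots> \<le> real k ^ 4"
      using Suc by (simp add: power_increasing)
    finally show ?thesis .
  qed simp
  then have G: "L2_sqnorm (jacobian (bubble c k)) \<le> ennreal (V * real k ^ 4)" for k
    unfolding J by (rule order_trans[OF V(2) ennreal_leI[OF mult_left_mono[OF _ V(1)]]])
  have "H1_sqnorm (bubble c k) \<le> ennreal ((C + V) * real k ^ 4)" for k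
  proof -
    have "has_weak_gradient (bubble c k) (jacobian (bubble c k))"
      by (rule has_weak_gradient_jacobian[where R = 2])
        (intro smooth_bubble tempered_eq_0 tempered_bubble(1) assms; assumption)+
    then have "H1_sqnorm (bubble c k) \<le> L2_sqnorm (bubble c k) + L2_sqnorm (jacobian (bubble c k))"
      unfolding H1_sqnorm_def by (intro INF_lower) simp
    also have "\<dots> \<le> ennreal (C * real k ^ 4) + ennreal (V * real k ^ 4)"
      by (intro add_mono C G)
    also have "\<dots> = ennreal ((C + V) * real k ^ 4)"
      using C(1) V(1) by (simp add: algebra_simps flip: ennreal_plus)
    finally show ?thesis .
  qed
  with that[of "C + V"] C(1) V(1) show ?thesis by simp
qed

text \<open>Replacing levels above \<open>n\<close> by 0 leaves finitely many values, hence a simple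
  function. At each \<open>t\<close> the approximation is exact as soon as \<open>n\<close> reaches
  \<open>level t\<close>.\<close>

lemma bochner_measurable_level:
  assumes "\<And>k. N (F k) < \<infinity>" "N (\<lambda>x. 0) = 0"
  shows "bochner_measurable N (\<lambda>t. F (level t))"
proof -
  define l where "l n t = (if level t \<le> n then level t else 0)" for n t
  have l: "simple_function (lebesgue_on {0<..}) (l n)" for n
  proof -
    have "l n \<in> borel \<rightarrow>\<^sub>M count_space UNIV"
      unfolding l_def by measurable
    then have "l n \<in> lebesgue_on {0<..} \<rightarrow>\<^sub>M count_space UNIV"
      by (intro measurable_restrict_space1 measurable_completion) simp
    moreover have "l n ` space (lebesgue_on {0<..}) \<subseteq> {..n}"
      by (auto simp: l_def)
    ultimately show ?thesis
      unfolding simple_function_def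
      using measurable_sets[of "l n" "lebesgue_on {0<..}" "count_space UNIV"]
      by (auto intro: finite_subset)
  qed
  have "(\<lambda>n. N (\<lambda>x. F (level t) x - F (l n t) x)) \<longlonglongrightarrow> 0" for t
  proof (rule tendsto_eventually)
    show "\<forall>\<^sub>F n in sequentially. N (\<lambda>x. F (level t) x - F (l n t) x) = 0"
      using eventually_ge_at_top[of "level t"]
      by eventually_elim (simp add: l_def assms(2))
  qed
  then show ?thesis
    unfolding bochner_measurable_def
    using simple_function_compose[OF l, of F] assms(1)
    by (intro exI[of _ "\<lambda>n t. F (l n t)"]) (simp add: comp_def)
qed

lemma bubble_0: "bubble c 0 = (\<lambda>x. 0)"
  by (simp add: bubble_def fun_eq_iff)

lemma Linf_L2_bubble: "(\<lambda>t. bubble c (level t)) \<in> Linf_L2"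
proof -
  obtain C where C: "\<And>k. L2_sqnorm (bubble c k) \<le> ennreal C"
    using L2_sqnorm_bubble by metis
  have "bochner_measurable L2_sqnorm (\<lambda>t. bubble c (level t))"
    by (rule bochner_measurable_level)
      (auto simp: L2_sqnorm_def[of "\<lambda>x. 0"] intro: le_less_trans[OF C])
  with C show ?thesis
    unfolding Linf_L2_def by (auto intro!: exI[of _ "ennreal C"])
qed

lemma L2_H1_bubble:
  assumes "\<And>k. norm (c k) \<le> 1"
  shows "(\<lambda>t. bubble c (level t)) \<in> L2_H1"
proof -
  obtain C where C: "C \<ge> 0" "\<And>k. H1_sqnorm (bubble c k) \<le> ennreal (C * real k ^ 4)"
    using H1_sqnorm_bubble[where c = c, OF assms] by blast
  \<comment> \<open>The zero field is the bubble of level 0, where the bound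
    \<open>C * real k ^ 4\<close> vanishes.\<close>
  have "H1_sqnorm (\<lambda>x. 0) = 0"
    using C(2)[of 0] by (simp add: bubble_0)
  then have "bochner_measurable H1_sqnorm (\<lambda>t. bubble c (level t))"
    by (intro bochner_measurable_level) (auto intro: le_less_trans[OF C(2)])
  moreover have "(\<integral>\<^sup>+t. H1_sqnorm (bubble c (level t)) \<partial>lebesgue_on {0<..}) < \<infinity>"
  proof -
    have "(\<integral>\<^sup>+t. H1_sqnorm (bubble c (level t)) \<partial>lebesgue_on {0<..})
        = (\<integral>\<^sup>+t. H1_sqnorm (bubble c (level t)) * indicator {0<..} t \<partial>lborel)"
      by (simp add: nn_integral_restrict_space nn_integral_completion)
    also have "\<dots> \<le> (\<integral>\<^sup>+t. ennreal C * ennreal (weight t) \<partial>lborel)"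
    proof (rule nn_integral_mono)
      fix t
      have "H1_sqnorm (bubble c (level t)) * indicator {0<..} t \<le> H1_sqnorm (bubble c (level t))"
        by (auto simp: indicator_def)
      also have "\<dots> \<le> ennreal (C * real (level t) ^ 4)"
        by (rule C)
      also have "\<dots> \<le> ennreal (C * weight t)"
        using C(1) by (intro ennreal_leI mult_left_mono level_power_le_weight)
      finally show "H1_sqnorm (bubble c (level t)) * indicator {0<..} t \<le> ennreal C * ennreal (weight t)"
        by (simp add: ennreal_mult' C(1))
    qed
    also have "\<dots> = ennreal C * (\<integral>\<^sup>+t. ennreal (weight t) \<partial>lborel)"
      by (rule nn_integral_cmult) simp
    also have "\<dots> < \<infinity>"
      using integrable_weight by (simp add: integrable_iff_bounded weight_nonneg ennreal_mult_less_top)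
    finally show ?thesis .
  qed
  ultimately show ?thesis
    by (simp add: L2_H1_def)
qed

section \<open>The singular set\<close>

text \<open>The code of a pair \<open>(j, m)\<close> is at least \<open>m\<close>, so the
  \<open>j\<close>-th point of a countable dense set recurs beyond every index. Points outside the
  closed unit ball are replaced by 0, which leaves those in the open ball unchanged.\<close>

lemma dense_repeating_sequence:
  obtains c :: "nat \<Rightarrow> real^3"
  where "\<And>k. norm (c k) \<le> 1"
    and "\<And>W m. open W \<Longrightarrow> W \<inter> ball 0 1 \<noteq> {} \<Longrightarrow> \<exists>k\<ge>m. c k \<in> W"
proof -
  obtain D :: "(real^3) set" where D: "countable D" "\<And>X. open X \<Longrightarrow> X \<noteq> {} \<Longrightarrow> \<exists>d\<in>D. d \<in> X"
    using countable_dense_setE by blast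
  define c where "c k = (let y = from_nat_into D (fst (prod_decode k)) in if norm y \<le> 1 then y else 0)" for k
  show ?thesis
  proof (rule that)
    show "norm (c k) \<le> 1" for k
      by (simp add: c_def Let_def)
    fix W :: "(real^3) set" and m
    assume "open W" "W \<inter> ball 0 1 \<noteq> {}"
    then obtain d where d: "d \<in> D" "d \<in> W" "norm d < 1"
      using D(2)[of "W \<inter> ball 0 1"] by auto
    then obtain j where "from_nat_into D j = d"
      using from_nat_into_surj[OF D(1)] by blast
    with d have "c (prod_encode (j, m)) \<in> W"
      by (simp add: c_def)
    then show "\<exists>k\<ge>m. c k \<in> W"
      using le_prod_encode_2 by blast
  qed
qed

text \<open>Otherwise a ball inside \<open>W\<close> would be a null set, against its positive
  volume. This turns an essential bound into a bound at an actual point.\<close>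

lemma AE_lebesgue_open_Ex:
  fixes W :: "'a::euclidean_space set"
  assumes "AE x in lebesgue. P x" "open W" "W \<noteq> {}"
  shows "\<exists>x\<in>W. P x"
proof (rule ccontr)
  assume neg: "\<not> (\<exists>x\<in>W. P x)"
  obtain y r where "r > 0" "ball y r \<subseteq> W"
    using assms(2,3) open_contains_ball by blast
  have "ball y r \<in> null_sets lebesgue"
  proof -
    have "AE x in lebesgue. x \<notin> ball y r"
      using assms(1) by eventually_elim (use neg \<open>ball y r \<subseteq> W\<close> in blast)
    then show ?thesis
      by (subst AE_iff_null_sets) auto
  qed
  then have "emeasure lborel (ball y r) = 0"
    by (simp add: null_sets_def)
  then show False
    using \<open>r > 0\<close> unit_ball_vol_pos[of "real DIM('a)"] by (simp add: emeasure_ball)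
qed

text \<open>The power -1/8 sends the endpoints, measured as distances to time 1, to
  \<open>k + 1\<close> and \<open>k + 2\<close>; hence the floor is \<open>k + 1\<close>.\<close>

lemma level_eq:
  assumes "1 - (1 / real (k + 1)) ^ 8 < t" "t < 1 - (1 / real (k + 2)) ^ 8"
  shows "level t = k"
proof -
  have root: "((1 / real (Suc n)) ^ 8) powr (- 1 / 8) = real (Suc n)" for n
  proof -
    have "(1 / real (Suc n)) ^ 8 = real (Suc n) powr (- 8)"
      by (simp add: powr_minus_divide power_divide del: of_nat_Suc)
    then show ?thesis
      by (simp add: powr_powr del: of_nat_Suc)
  qed
  have "0 < (1 / real (k + 2)) ^ 8"
    by simp
  then have pos: "0 < 1 - t"
    using assms(2) by linarith
  have "((1 / real (Suc k)) ^ 8) powr (- 1 / 8) < (1 - t) powr (- 1 / 8)"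
    by (rule powr_less_mono2_neg) (use assms pos in simp_all)
  moreover have "(1 - t) powr (- 1 / 8) < ((1 / real (Suc (Suc k))) ^ 8) powr (- 1 / 8)"
    by (rule powr_less_mono2_neg) (use assms pos in simp_all)
  ultimately have "\<lfloor>(1 - t) powr (- 1 / 8)\<rfloor> = int k + 1"
    unfolding root by (intro floor_unique) auto
  then have "nat \<lfloor>(1 - t) powr (- 1 / 8)\<rfloor> - 1 = k"
    by simp
  moreover have "t < 1"
    using pos by simp
  ultimately show ?thesis
    by (simp only: level_def if_True)
qed

lemma singular_set_bubble:
  assumes dense: "\<And>W m. open W \<Longrightarrow> W \<inter> ball 0 1 \<noteq> {} \<Longrightarrow> \<exists>k\<ge>m. c k \<in> W"
    and "norm y < 1"
  shows "(1, y) \<in> singular_set (\<lambda>t. bubble c (level t))"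
proof -
  have "\<not> regular_point (\<lambda>t. bubble c (level t)) (1, y)"
  proof
    assume "regular_point (\<lambda>t. bubble c (level t)) (1, y)"
    then obtain U C where U: "open U" "(1, y) \<in> U"
      and AE: "AE (t, x) in lebesgue. (t, x) \<in> U \<longrightarrow> norm (bubble c (level t) x) \<le> C"
      unfolding regular_point_def by blast
    obtain A B where AB: "open A" "open B" "(1, y) \<in> A \<times> B" "A \<times> B \<subseteq> U"
      using open_prod_elim[OF U] by blast
    obtain \<delta> where \<delta>: "\<delta> > 0" "ball 1 \<delta> \<subseteq> A"
      using AB by (meson mem_Sigma_iff open_contains_ball)
    obtain \<eta> where \<eta>: "\<eta> > 0" "ball y \<eta> \<subseteq> B"
      using AB by (meson mem_Sigma_iff open_contains_ball)
    define e :: "real^3" where "e = axis 1 (1 / 2)"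
    \<comment> \<open>The three thresholds put the time interval within \<open>\<delta>\<close> of
      1, make the bubble small compared with \<open>\<eta>\<close>, and lift its amplitude above
      \<open>C\<close>.\<close>
    obtain m1 where m1: "1 / \<delta> < real m1" using reals_Archimedean2 by blast
    obtain m2 where m2: "1 / \<eta> < real m2" using reals_Archimedean2 by blast
    obtain m3 where m3: "C / norm (swirl e) < real m3" using reals_Archimedean2 by blast
    have "y \<in> ball y (\<eta> / 2) \<inter> ball 0 1"
      using \<eta>(1) assms(2) by simp
    then obtain k where k: "k \<ge> max m1 (max m2 m3)" "c k \<in> ball y (\<eta> / 2)"
      using dense[of "ball y (\<eta> / 2)" "max m1 (max m2 m3)"] by blast
    define T where "T = {1 - (1 / real (k + 1)) ^ 8 <..< 1 - (1 / real (k + 2)) ^ 8}"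
    \<comment> \<open>By continuity \<open>V\<close> is open, so the bound \<open>C\<close> is
      exceeded on the nonempty open box \<open>T \<times> V\<close> and not merely at one
      point.\<close>
    define V where "V = ball y \<eta> \<inter> {x. C < norm (bubble c k x)}"
    have "open V"
      unfolding V_def
      by (intro open_Int open_Collect_less continuous_intros smooth_continuous_on smooth_bubble) auto
    have "T \<noteq> {}"
    proof -
      have "(1 / real (k + 2)) ^ 8 < (1 / real (k + 1)) ^ 8"
        by (intro power_strict_mono divide_strict_left_mono) auto
      then show ?thesis
        unfolding T_def greaterThanLessThan_empty_iff by linarith
    qed
    have "V \<noteq> {}"
    proof -
      \<comment> \<open>The rescaling of the bubble maps this point to \<open>e\<close>, where the
        swirl is nonzero.\<close>
      let ?x = "c k + (1 / real (Suc k)) *\<^sub>R e"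
      have "norm ((1 / real (Suc k)) *\<^sub>R e) < \<eta> / 2"
      proof -
        have "1 / \<eta> < real (Suc k)"
          using m2 k(1) by simp
        then have "1 / real (Suc k) < \<eta>"
          using \<eta>(1) by (simp add: field_simps del: of_nat_Suc)
        moreover have "norm e = 1 / 2"
          by (simp add: e_def norm_eq_sqrt_inner inner_axis_axis real_sqrt_divide)
        ultimately show ?thesis
          by (simp del: of_nat_Suc)
      qed
      then have "?x \<in> ball y \<eta>"
        using k(2) dist_triangle[of y ?x "c k"]
        by (simp add: dist_norm[of "c k"] del: of_nat_Suc norm_scaleR)
      moreover have "C < norm (bubble c k ?x)"
      proof -
        have "C < real m3 * norm (swirl e)"
          using m3 swirl_nonzero by (simp add: e_def field_simps)
        also have "\<dots> \<le> real k * norm (swirl e)"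
          using k(1) by (intro mult_right_mono) auto
        also have "\<dots> = norm (bubble c k ?x)"
          by (simp add: bubble_def del: of_nat_Suc)
        finally show ?thesis .
      qed
      ultimately show ?thesis
        unfolding V_def by blast
    qed
    have "open (T \<times> V)" "T \<times> V \<noteq> {}"
      using \<open>open V\<close> \<open>T \<noteq> {}\<close> \<open>V \<noteq> {}\<close> by (auto simp: T_def open_Times)
    from AE_lebesgue_open_Ex[OF AE this]
    obtain t x where tx: "t \<in> T" "x \<in> V" "(t, x) \<in> U \<longrightarrow> norm (bubble c (level t) x) \<le> C"
      by auto
    have "level t = k"
      using tx(1) by (intro level_eq) (auto simp: T_def)
    moreover have "t \<in> ball 1 \<delta>"
    proof -
      have "1 / \<delta> < real (k + 1)"
        using m1 k(1) by simp
      then have "1 / real (k + 1) < \<delta>"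
        using \<delta>(1) by (simp add: field_simps del: of_nat_Suc)
      moreover have "(1 / real (k + 1)) ^ 8 \<le> (1 / real (k + 1)) ^ 1"
        by (intro power_decreasing) auto
      moreover have "0 < (1 / real (k + 2)) ^ 8"
        by simp
      moreover have "1 - (1 / real (k + 1)) ^ 8 < t" "t < 1 - (1 / real (k + 2)) ^ 8"
        using tx(1) by (auto simp: T_def)
      ultimately have "1 - t < \<delta>" "0 < 1 - t"
        unfolding power_one_right by linarith+
      then show ?thesis
        by (simp add: dist_real_def)
    qed
    moreover have "x \<in> B" "C < norm (bubble c k x)"
      using tx(2) \<eta>(2) by (auto simp: V_def)
    ultimately show False
      using tx(3) \<delta>(2) AB(4) by (metis mem_Sigma_iff not_le subsetD)
  qed
  then show ?thesis
    by (simp add: singular_set_def)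
qed

text \<open>A cover of \<open>{1} \<times> B\<close> by sets of diameters \<open>d i \<le> 1\<close> gives a cover of the unit ball \<open>B\<close> by
  balls of radii \<open>d i\<close>, whose total volume is at most a multiple of \<open>\<Sum>i. d i powr s\<close> if \<open>s \<le> 3\<close>.\<close>

lemma hausdorff_dim_ge_3:
  fixes S :: "(real \<times> (real^3)) set"
  assumes S: "\<And>x. norm x < 1 \<Longrightarrow> (a, x) \<in> S"
  shows "3 \<le> hausdorff_dim S"
  unfolding hausdorff_dim_def
proof (rule INF_greatest, rule ccontr)
  fix s assume "s \<in> {s. 0 < s \<and> hausdorff_measure s S = 0}" and "\<not> 3 \<le> ereal s"
  then have s: "0 < s" "s < 3" "hausdorff_measure s S = 0"
    by (auto simp: not_le)
  \<comment> \<open>At scale 1 all diameters are at most 1, where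
    \<open>d ^ 3 \<le> d powr s\<close> for \<open>s < 3\<close>. A sum below 1 will contradict the
    volume of the unit ball.\<close>
  have "hausdorff_premeasure s 1 S \<le> hausdorff_measure s S"
    unfolding hausdorff_measure_def by (rule SUP_upper) simp
  then have "hausdorff_premeasure s 1 S < 1"
    using s(3) by simp
  then obtain U :: "nat \<Rightarrow> (real \<times> (real^3)) set" where U: "S \<subseteq> (\<Union>i. U i)"
      "\<And>i. bounded (U i)" "\<And>i. diameter (U i) \<le> 1"
    and sum: "(\<Sum>i. ennreal (diameter (U i) powr s)) < 1"
    unfolding hausdorff_premeasure_def INF_less_iff by blast
  define d where "d i = diameter (U i)" for i
  \<comment> \<open>For an empty \<open>U i\<close> the point is arbitrary; the cover below only
    relies on indices whose set contains a point of \<open>S\<close>.\<close>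
  define y where "y i = snd (SOME p. p \<in> U i)" for i
  have d: "0 \<le> d i" "d i \<le> 1" for i
    using U diameter_ge_0 by (auto simp: d_def)
  let ?V = "ennreal (unit_ball_vol 3)"
  have "ball 0 1 \<subseteq> (\<Union>i. cball (y i) (d i))"
  proof
    fix x :: "real^3" assume "x \<in> ball 0 1"
    then obtain i where i: "(a, x) \<in> U i"
      using S U(1) by auto
    then have "(SOME p. p \<in> U i) \<in> U i"
      by (rule someI)
    then have "dist (SOME p. p \<in> U i) (a, x) \<le> d i"
      unfolding d_def using U(2) i diameter_bounded_bound by blast
    then have "dist (y i) x \<le> d i"
      using dist_snd_le[of "SOME p. p \<in> U i" "(a, x)"] by (simp add: y_def)
    then show "x \<in> (\<Union>i. cball (y i) (d i))" by auto
  qed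
  then have "emeasure lborel (ball (0::real^3) 1) \<le> emeasure lborel (\<Union>i. cball (y i) (d i))"
    by (rule emeasure_mono) simp
  also have "\<dots> \<le> (\<Sum>i. emeasure lborel (cball (y i) (d i)))"
    by (rule emeasure_subadditive_countably) auto
  also have "\<dots> \<le> (\<Sum>i. ?V * ennreal (d i powr s))"
  proof (intro suminf_le)
    fix i
    \<comment> \<open>For \<open>d i = 0\<close> both sides vanish, since
      \<open>0 powr s = 0\<close>.\<close>
    have "d i ^ 3 \<le> d i powr s"
    proof (cases "d i = 0")
      case False
      then have "d i ^ 3 = d i powr 3"
        using d(1)[of i] by (simp add: powr_numeral)
      also have "\<dots> \<le> d i powr s"
        using s d by (intro powr_mono') auto
      finally show ?thesis .
    qed simp
    then show "emeasure lborel (cball (y i) (d i)) \<le> ?V * ennreal (d i powr s)"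
      using d(1)[of i] by (simp add: emeasure_cball mult_left_mono flip: ennreal_mult)
  qed auto
  also have "\<dots> = ?V * (\<Sum>i. ennreal (d i powr s))"
    by simp
  also have "\<dots> < ?V * 1"
    using sum unfolding d_def by (intro ennreal_mult_strict_left_mono) auto
  finally show False
    by (simp add: emeasure_ball)
qed

theorem proposition2p1:
  fixes \<alpha> :: real
  assumes "0 < \<alpha>" and "\<alpha> < 3/2"
  shows "\<exists>(z0 :: real^3 \<Rightarrow> real^3) (f :: real \<Rightarrow> real^3 \<Rightarrow> real^3) (g :: real \<Rightarrow> real^3 \<Rightarrow> real^3)
           (z :: real \<Rightarrow> real^3 \<Rightarrow> real^3).
           locally_integrable spacetime0 (\<lambda>(t, x). f t x) \<and>
           locally_integrable spacetime0 (\<lambda>(t, x). g t x) \<and>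
           stokes_solution z0 f g z \<and>
           z \<in> Linf_L2 \<inter> L2_H1 \<and>
           compact (closure {(t, x). 0 \<le> t \<and> z t x \<noteq> 0}) \<and>
           (\<forall>t\<ge>0. smooth (z t)) \<and>
           ereal \<alpha> \<le> hausdorff_dim (singular_set z)"
proof -
  obtain c :: "nat \<Rightarrow> real^3" where c: "\<And>k. norm (c k) \<le> 1"
    and dense: "\<And>W m. open W \<Longrightarrow> W \<inter> ball 0 1 \<noteq> {} \<Longrightarrow> \<exists>k\<ge>m. c k \<in> W"
    using dense_repeating_sequence by blast
  define z where "z t = bubble c (level t)" for t
  have z: "z = (\<lambda>t. bubble c (level t))"
    by (auto simp: z_def)
  have T: "tempered (bubble c)" "tempered (\<lambda>k. lap (bubble c k))"
    using tempered_bubble(1)[where c = c, OF c] tempered_lap_bubble[where c = c, OF c] .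
  have int_lap: "integrable lborel (\<lambda>(t, x). - lap (z t) x)"
    using tempered_integrable[OF T(2)] unfolding z by (simp add: case_prod_beta')
  have int_z: "integrable lborel (\<lambda>(t, x). z t x)"
    using tempered_integrable[OF T(1)] unfolding z .
  \<comment> \<open>After time 1 the level is 0, whose bubble is the zero field; up to time 1 the
    common support ball applies.\<close>
  have "z t x = 0" if "0 \<le> t" "(t, x) \<notin> {0..1} \<times> cball 0 2" for t x
    using that tempered_eq_0[OF T(1), of x] by (auto simp: z_def level_def bubble_0)
  then have "{(t, x). 0 \<le> t \<and> z t x \<noteq> 0} \<subseteq> {0..1} \<times> cball 0 2"
    by blast
  then have compact: "compact (closure {(t, x). 0 \<le> t \<and> z t x \<noteq> 0})"
    unfolding compact_closure
    by (rule bounded_subset[OF bounded_Times[OF compact_imp_bounded[OF compact_Icc] bounded_cball]])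
  have "3 \<le> hausdorff_dim (singular_set z)"
    unfolding z by (rule hausdorff_dim_ge_3[where a = 1], rule singular_set_bubble[OF dense])
  moreover have "ereal \<alpha> \<le> 3"
    using assms(2) by simp
  ultimately have dim: "ereal \<alpha> \<le> hausdorff_dim (singular_set z)"
    by (rule order_trans[rotated])
  have "stokes_solution (\<lambda>x. 0) (\<lambda>t x. - lap (z t) x) z z" "z \<in> Linf_L2 \<inter> L2_H1"
    unfolding z using stokes_bubble[where c = c, OF c] Linf_L2_bubble L2_H1_bubble[where c = c, OF c]
    by blast+
  moreover have "\<forall>t\<ge>0. smooth (z t)"
    by (simp add: z_def smooth_bubble)
  ultimately show ?thesis
    using compact dim locally_integrable_lborel[OF int_lap] locally_integrable_lborel[OF int_z]
    by blast
qed

end
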